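(* Let $A\in\{0,1\}^\omega$. The following are equivalent. (1) There is a set $B\in\{0,1\}^\omega$ such that $A\le_{T(tu)} B$. (2) $A$ is anti-complex. (3) The weak truth-table degree $\deg_{wtt}(A)$ is r.e. traceable. (4) $A$ is weak truth-table reducible to a Schnorr trivial set.
   Context: Sets are subsets of $\omega$, identified with elements of $\{0,1\}^\omega$; $A\upharpoonright n$ denotes the string $A(0)A(1)\cdots A(n-1)$. "Recursive" means computable, "r.e." means recursively enumerable. An order function (order) is a recursive function $h:\omega\to\omega$ that is nondecreasing and unbounded. Use: if $\Phi$ is a Turing reduction (oracle machine) with $\Phi^B=A$, where before computing $\Phi^B(n)$ the machine first computes $\Phi^B(m)$ for all $m<n$, then the use function is $\varphi(n)=m+1$ where $m$ is the largest number queried by $\Phi$ while computing $A\upharpoonright n$ (and $\varphi(n)=0$ if there are no queries). $A\le_{T(tu)}B$ ($A$ is reducible to $B$ with tiny use) means: for every order function $h$ there is a Turing reduction of $A$ to $B$ whose use function is bounded by $h$. Weak truth-table reducibility $\le_{wtt}$ is Turing reducibility via a reduction whose use is bounded by a recursive function; $f\le_{wtt}A$ for functions $f:\omega\to\omega$ is defined in the same way. Plain complexity: a machine is a partial recursive $M:\{0,1\}^*\to\{0,1\}^*$; $C_M(\sigma)$ is the length of a shortest $\tau$ with $M(\tau)=\sigma$ ($\infty$ if none). A machine $U$ is optimal if for every machine $M$ there is a constant $c$ with $C_U(\sigma)\le C_M(\sigma)+c$ for all $\sigma$; $C=C_U$ for a fixed optimal $U$. $A$ is anti-complex if for every order function $f$,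 for all but finitely many $n$, $C(A\upharpoonright f(n))\le n$. Traceability: an r.e. trace for $f:\omega\to\omega$ is a uniformly r.e. sequence $\langle T_n\rangle$ of finite sets with $f(n)\in T_n$ for all $n$; it is bounded by $h$ if $|T_n|\le h(n)$ for all $n$. A weak truth-table degree $\mathbf a$ is r.e. traceable if there is an order function $h$ such that every $f\le_{wtt}\mathbf a$ has an r.e. trace bounded by $h$. Schnorr triviality (Downey–Griffiths): a set $S$ is Schnorr trivial if for every prefix-free machine $M$ whose domain has recursive measure $\sum_{\tau\in\mathrm{dom} M}2^{-|\tau|}$ there are a prefix-free machine $N$ whose domain has recursive measure and a constant $c$ such that $C_N(S\upharpoonright n)\le C_M(n)+c$ for all $n$ (numbers are identified with strings). By a theorem of Franklin and Stephan this is equivalent to the truth-table degree of $S$ being recursively traceable: there is an order $h$ such that every $f\le_{tt}S$ has a trace $\langle T_n\rangle$ with $|T_n|\le h(n)$ given recursively, i.e. by a recursive sequence of canonical indices of finite sets. *)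

theory Defs
  imports "HOL-Analysis.Infinite_Sum" "HOL-Library.Extended_Nat" "HOL-Library.Nat_Bijection"
    "HOL-Library.Sublist"
begin

section \<open>Oracle computations\<close>

text \<open>
  Oracle programs are presented as Kleene-style codes for unary partial functions on the natural
  numbers, several arguments being packed into one with the pairing function \<^const>\<open>prod_encode\<close>.
  Evaluation is strict, so the queries made along a computation are determined by the program, the
  oracle and the input.
\<close>

datatype prog =
    PZero
  | PSucc
  | PFst
  | PSnd
  | PQuery
  | PPair prog prog
  | PComp prog prog
  | PRec prog prog
  | PMin prog

text \<open>
  \<open>run B e x y Q\<close>: with oracle \<open>B\<close>, the program \<open>e\<close> halts on input \<open>x\<close> with output \<open>y\<close>, and \<open>Q\<close> is
  the set of numbers queried during this computation.
\<close>

inductive run :: "nat set \<Rightarrow> prog \<Rightarrow> nat \<Rightarrow> nat \<Rightarrow> nat set \<Rightarrow> bool" for B :: "nat set" where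
  run_zero: "run B PZero x 0 {}"
| run_succ: "run B PSucc x (Suc x) {}"
| run_fst: "run B PFst x (fst (prod_decode x)) {}"
| run_snd: "run B PSnd x (snd (prod_decode x)) {}"
| run_query: "run B PQuery x (of_bool (x \<in> B)) {x}"
| run_pair: "\<lbrakk>run B f x y Q; run B g x z R\<rbrakk>
    \<Longrightarrow> run B (PPair f g) x (prod_encode (y, z)) (Q \<union> R)"
| run_comp: "\<lbrakk>run B g x y Q; run B f y z R\<rbrakk> \<Longrightarrow> run B (PComp f g) x z (Q \<union> R)"
| run_rec_0: "run B f a y Q \<Longrightarrow> run B (PRec f g) (prod_encode (a, 0)) y Q"
| run_rec_Suc: "\<lbrakk>run B (PRec f g) (prod_encode (a, n)) y Q;
      run B g (prod_encode (a, prod_encode (n, y))) z R\<rbrakk>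
    \<Longrightarrow> run B (PRec f g) (prod_encode (a, Suc n)) z (Q \<union> R)"
| run_min: "\<lbrakk>\<And>i. i < n \<Longrightarrow> run B f (prod_encode (x, i)) (Suc (v i)) (R i);
      run B f (prod_encode (x, n)) 0 (R n)\<rbrakk>
    \<Longrightarrow> run B (PMin f) x n (\<Union>i\<le>n. R i)"

lemma run_deterministic:
  assumes "run B e x y Q" and "run B e x y' Q'"
  shows "y = y' \<and> Q = Q'"
  using assms
proof (induction arbitrary: y' Q' rule: run.induct)
  case (run_zero x)
  then show ?case by (cases rule: run.cases) simp_all
next
  case (run_succ x)
  then show ?case by (cases rule: run.cases) simp_all
next
  case (run_fst x)
  then show ?case by (cases rule: run.cases) simp_all
next
  case (run_snd x)
  then show ?case by (cases rule: run.cases) simp_all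
next
  case (run_query x)
  then show ?case by (cases rule: run.cases) simp_all
next
  case (run_pair f x y Q g z R)
  from run_pair.prems obtain u P v P' where
    *: "y' = prod_encode (u, v)" "Q' = P \<union> P'" "run B f x u P" "run B g x v P'"
    by (cases rule: run.cases) simp_all
  then show ?case
    using run_pair.IH(1)[OF *(3)] run_pair.IH(2)[OF *(4)] by simp
next
  case (run_comp g x y Q f z R)
  from run_comp.prems obtain u P P' where
    *: "Q' = P \<union> P'" "run B g x u P" "run B f u y' P'"
    by (cases rule: run.cases) simp_all
  have "y = u \<and> Q = P" using run_comp.IH(1)[OF *(2)] .
  then show ?case
    using *(1,3) run_comp.IH(2)[of y' P'] by simp
next
  case (run_rec_0 f a y Q g)
  from run_rec_0.prems have "run B f a y' Q'"
    by (cases rule: run.cases) simp_all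
  then show ?case by (rule run_rec_0.IH)
next
  case (run_rec_Suc f g a n y Q z R)
  from run_rec_Suc.prems obtain u P P' where
    *: "Q' = P \<union> P'" "run B (PRec f g) (prod_encode (a, n)) u P"
      "run B g (prod_encode (a, prod_encode (n, u))) y' P'"
    by (cases rule: run.cases) simp_all
  have "y = u \<and> Q = P" using run_rec_Suc.IH(1)[OF *(2)] .
  then show ?case
    using *(1,3) run_rec_Suc.IH(2)[of y' P'] by simp
next
  case (run_min n f x v R)
  from run_min.prems obtain v' R' where
    Q': "Q' = (\<Union>i\<le>y'. R' i)"
    and less: "\<And>i. i < y' \<Longrightarrow> run B f (prod_encode (x, i)) (Suc (v' i)) (R' i)"
    and zero: "run B f (prod_encode (x, y')) 0 (R' y')"
  proof (cases rule: run.cases)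
    case (run_min v R)
    then show ?thesis by (rule that)
  qed
  have "\<not> y' < n"
    using run_min.IH(1)[OF _ zero] by auto
  moreover have "\<not> n < y'"
    using run_min.IH(2)[OF less] by auto
  ultimately have eq: "y' = n" by simp
  have "R i = R' i" if "i \<le> n" for i
  proof (cases "i = n")
    case True
    then show ?thesis using run_min.IH(2)[OF zero[unfolded eq]] eq by simp
  next
    case False
    with that have "i < n" by simp
    then show ?thesis using run_min.IH(1)[OF _ less[of i]] eq by simp
  qed
  then show ?case using eq Q' by simp
qed

lemma run_finite_queries: "run B e x y Q \<Longrightarrow> finite Q"
proof (induction rule: run.induct)
  case (run_min n f x v R)
  then have "finite (R i)" if "i \<le> n" for i
    using that by (cases "i = n") simp_all
  then show ?case by simp
qed simp_all

definition computes :: "prog \<Rightarrow> nat set \<Rightarrow> (nat \<Rightarrow> nat) \<Rightarrow> bool" where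
  "computes e B f \<longleftrightarrow> (\<forall>n. \<exists>Q. run B e n (f n) Q)"

definition queries :: "prog \<Rightarrow> nat set \<Rightarrow> nat \<Rightarrow> nat set" where
  "queries e B n = \<Union> {Q. \<exists>y. run B e n y Q}"

lemma queries_eq: "run B e n y Q \<Longrightarrow> queries e B n = Q"
  unfolding queries_def by (auto dest: run_deterministic)

text \<open>
  The value at \<open>n\<close> concerns the computation of the first \<open>n\<close> values, not of the value at \<open>n\<close>.
\<close>

definition use_fun :: "prog \<Rightarrow> nat set \<Rightarrow> nat \<Rightarrow> nat" where
  "use_fun e B n =
    (let Q = (\<Union>m<n. queries e B m) in if Q = {} then 0 else Max Q + 1)"

definition char_fun :: "nat set \<Rightarrow> nat \<Rightarrow> nat" where
  "char_fun A n = of_bool (n \<in> A)"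


section \<open>Recursive functions and reducibilities\<close>

definition recursive :: "(nat \<Rightarrow> nat) \<Rightarrow> bool" where
  "recursive f \<longleftrightarrow> (\<exists>e. computes e {} f)"

definition partial_recursive :: "(nat \<Rightarrow> nat option) \<Rightarrow> bool" where
  "partial_recursive \<psi> \<longleftrightarrow> (\<exists>e. \<forall>x y. \<psi> x = Some y \<longleftrightarrow> (\<exists>Q. run {} e x y Q))"

definition order_function :: "(nat \<Rightarrow> nat) \<Rightarrow> bool" where
  "order_function h \<longleftrightarrow> recursive h \<and> mono h \<and> \<not> bdd_above (range h)"

definition tiny_use_reducible :: "nat set \<Rightarrow> nat set \<Rightarrow> bool" where
  "tiny_use_reducible A B \<longleftrightarrow>
    (\<forall>h. order_function h \<longrightarrow>
      (\<exists>e. computes e B (char_fun A) \<and> (\<forall>n. use_fun e B n \<le> h n)))"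

definition fun_wtt_reducible :: "(nat \<Rightarrow> nat) \<Rightarrow> nat set \<Rightarrow> bool" where
  "fun_wtt_reducible f B \<longleftrightarrow>
    (\<exists>e g. computes e B f \<and> recursive g \<and> (\<forall>n. use_fun e B n \<le> g n))"

definition wtt_reducible :: "nat set \<Rightarrow> nat set \<Rightarrow> bool" where
  "wtt_reducible A B \<longleftrightarrow> fun_wtt_reducible (char_fun A) B"

definition wtt_degree :: "nat set \<Rightarrow> nat set set" where
  "wtt_degree A = {X. wtt_reducible X A \<and> wtt_reducible A X}"


section \<open>Traceability\<close>

definition re_set :: "nat set \<Rightarrow> bool" where
  "re_set W \<longleftrightarrow> (\<exists>\<psi>. partial_recursive \<psi> \<and> W = dom \<psi>)"

definition uniformly_re :: "(nat \<Rightarrow> nat set) \<Rightarrow> bool" where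
  "uniformly_re T \<longleftrightarrow> re_set {prod_encode (n, x) | n x. x \<in> T n}"

definition re_trace :: "(nat \<Rightarrow> nat set) \<Rightarrow> (nat \<Rightarrow> nat) \<Rightarrow> bool" where
  "re_trace T f \<longleftrightarrow> uniformly_re T \<and> (\<forall>n. finite (T n)) \<and> (\<forall>n. f n \<in> T n)"

definition re_traceable_degree :: "nat set set \<Rightarrow> bool" where
  "re_traceable_degree d \<longleftrightarrow>
    (\<exists>h. order_function h \<and>
      (\<forall>f. (\<exists>X\<in>d. fun_wtt_reducible f X) \<longrightarrow>
        (\<exists>T. re_trace T f \<and> (\<forall>n. card (T n) \<le> h n))))"


section \<open>Strings, machines and complexity\<close>

definition initial_segment :: "nat set \<Rightarrow> nat \<Rightarrow> bool list" where
  "initial_segment A n = map (\<lambda>i. i \<in> A) [0..<n]"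

text \<open>
  The position of a string in the length-lexicographic ordering; this identifies strings with
  numbers.
\<close>

definition nat_of_str :: "bool list \<Rightarrow> nat" where
  "nat_of_str \<sigma> = foldl (\<lambda>k b. 2 * k + (if b then 2 else 1)) 0 \<sigma>"

definition str_of_nat :: "nat \<Rightarrow> bool list" where
  "str_of_nat = inv nat_of_str"

lemma nat_of_str_snoc: "nat_of_str (\<sigma> @ [b]) = 2 * nat_of_str \<sigma> + (if b then 2 else 1)"
  by (simp add: nat_of_str_def)

lemma bij_nat_of_str: "bij nat_of_str"
proof (rule bijI)
  have "nat_of_str \<sigma> = nat_of_str \<tau> \<Longrightarrow> \<sigma> = \<tau>" for \<sigma> \<tau>
  proof (induction \<sigma> arbitrary: \<tau> rule: rev_induct)
    case Nil
    then show ?case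
      by (cases \<tau> rule: rev_cases) (auto simp: nat_of_str_snoc nat_of_str_def split: if_splits)
  next
    case (snoc b \<sigma>)
    show ?case
    proof (cases \<tau> rule: rev_cases)
      case Nil
      then show ?thesis
        using snoc.prems by (simp add: nat_of_str_snoc) (simp add: nat_of_str_def split: if_splits)
    next
      case (snoc \<tau>' b')
      then have *: "2 * nat_of_str \<sigma> + (if b then 2 else 1) =
          2 * nat_of_str \<tau>' + (if b' then 2 else 1)"
        using snoc.prems by (simp only: nat_of_str_snoc)
      then have "b = b'" by (auto split: if_splits) presburger+
      then have "nat_of_str \<sigma> = nat_of_str \<tau>'" using * by simp
      then show ?thesis using snoc \<open>b = b'\<close> snoc.IH by simp
    qed
  qed
  then show "inj nat_of_str" by (rule injI)
  have "\<exists>\<sigma>. nat_of_str \<sigma> = n" for n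
  proof (induction n rule: less_induct)
    case (less n)
    show ?case
    proof (cases "n = 0")
      case True
      then show ?thesis by (intro exI[of _ "[]"]) (simp add: nat_of_str_def)
    next
      case False
      then have "(n - 1) div 2 < n" by simp
      then obtain \<sigma> where "nat_of_str \<sigma> = (n - 1) div 2" using less by blast
      with False have "nat_of_str (\<sigma> @ [even n]) = n"
        by (auto simp: nat_of_str_snoc elim!: evenE oddE)
      then show ?thesis by blast
    qed
  qed
  then show "surj nat_of_str" unfolding surj_def by (metis (lifting))
qed

definition machine :: "(bool list \<Rightarrow> bool list option) \<Rightarrow> bool" where
  "machine M \<longleftrightarrow> partial_recursive (\<lambda>x. map_option nat_of_str (M (str_of_nat x)))"

definition complexity :: "(bool list \<Rightarrow> bool list option) \<Rightarrow> bool list \<Rightarrow> enat" where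
  "complexity M \<sigma> = (INF \<tau>\<in>{\<tau>. M \<tau> = Some \<sigma>}. enat (length \<tau>))"

definition optimal :: "(bool list \<Rightarrow> bool list option) \<Rightarrow> bool" where
  "optimal U \<longleftrightarrow> machine U \<and>
    (\<forall>M. machine M \<longrightarrow> (\<exists>c. \<forall>\<sigma>. complexity U \<sigma> \<le> complexity M \<sigma> + enat c))"

text \<open>The parameter \<open>U\<close> is the optimal machine with respect to which plain complexity is taken.\<close>

definition anti_complex :: "(bool list \<Rightarrow> bool list option) \<Rightarrow> nat set \<Rightarrow> bool" where
  "anti_complex U A \<longleftrightarrow>
    (\<forall>f. order_function f \<longrightarrow>
      (\<forall>\<^sub>F n in sequentially. complexity U (initial_segment A (f n)) \<le> enat n))"


section \<open>Schnorr triviality\<close>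

definition prefix_free_machine :: "(bool list \<Rightarrow> bool list option) \<Rightarrow> bool" where
  "prefix_free_machine M \<longleftrightarrow>
    machine M \<and> (\<forall>\<sigma>\<in>dom M. \<forall>\<tau>\<in>dom M. prefix \<sigma> \<tau> \<longrightarrow> \<sigma> = \<tau>)"

text \<open>A real is recursive if it is the limit of a recursive fast-converging rational sequence.\<close>

definition recursive_real :: "real \<Rightarrow> bool" where
  "recursive_real r \<longleftrightarrow>
    (\<exists>a b d. recursive a \<and> recursive b \<and> recursive d \<and>
      (\<forall>k. \<bar>r - (real (a k) - real (b k)) / (real (d k) + 1)\<bar> \<le> (1 / 2) ^ k))"

definition recursive_measure_domain :: "(bool list \<Rightarrow> bool list option) \<Rightarrow> bool" where
  "recursive_measure_domain M \<longleftrightarrow>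
    (\<exists>r. ((\<lambda>\<tau>. (1 / 2) ^ length \<tau>) has_sum r) (dom M) \<and> recursive_real r)"

definition schnorr_trivial :: "nat set \<Rightarrow> bool" where
  "schnorr_trivial S \<longleftrightarrow>
    (\<forall>M. prefix_free_machine M \<and> recursive_measure_domain M \<longrightarrow>
      (\<exists>N c. prefix_free_machine N \<and> recursive_measure_domain N \<and>
        (\<forall>n. complexity N (initial_segment S n) \<le> complexity M (str_of_nat n) + enat c)))"

end

theory Submission
  imports Defs
begin

text \<open>
  Anti-complexity is the central notion. Let \<open>U\<close> be optimal and let \<open>A\<close> be anti-complex. Among the
  halting times of \<open>U\<close> on inputs below \<open>2 ^ Suc k\<close>, let \<open>p k\<close> be the largest one for which some
  \<open>U\<close>-program below \<open>2 ^ Suc k\<close> outputs at least the first \<open>p k\<close> bits of \<open>A\<close>. Then \<open>p\<close> dominates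
  every recursive function, since the values of a recursive function have short programs whose halting
  times are bounded by a recursive function, and the two programs involved form a small code \<open>c k\<close> from which
  \<open>p k \<le> x\<close> can be decided and the first \<open>p k\<close> bits of \<open>A\<close> can be computed.

  The set of all \<open>\<langle>k, c k\<rangle>\<close> computes \<open>A\<close> with tiny use. The set \<open>S\<close> of all
  \<open>\<langle>x, c (K x)\<rangle>\<close>, where \<open>K x\<close> is least with \<open>x < p (K x)\<close>, computes \<open>A\<close> with recursively bounded
  use, and it is Schnorr trivial: as \<open>p\<close> dominates a given recursive \<open>u\<close>, the part of \<open>S\<close> below
  \<open>u m\<close> is recovered recursively from \<open>c 0, \<dots>, c m\<close>, for which there are few possibilities. A machine
  of recursive domain measure is then split into batches of rapidly decreasing weight, so that every
  program in batch \<open>m\<close> can be replaced by one program for each of the possibilities.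

  Conversely, tiny use, an r.e. trace with a fixed bound, or a Schnorr trivial oracle (tested with the
  machine that maps \<open>0\<^sup>k 1\<close> to a fast growing function of \<open>k\<close>) provide descriptions of length about
  \<open>n div 2\<close> of an oracle prefix that suffices to compute the first \<open>f n\<close> bits of \<open>A\<close>.
\<close>

section \<open>Closure properties of the recursive functions\<close>

abbreviation lft :: "nat \<Rightarrow> nat" where "lft z \<equiv> fst (prod_decode z)"
abbreviation rgt :: "nat \<Rightarrow> nat" where "rgt z \<equiv> snd (prod_decode z)"
abbreviation pair :: "nat \<Rightarrow> nat \<Rightarrow> nat" where "pair x y \<equiv> prod_encode (x, y)"

abbreviation recursive2 :: "(nat \<Rightarrow> nat \<Rightarrow> nat) \<Rightarrow> bool" where
  "recursive2 f \<equiv> recursive (\<lambda>z. f (lft z) (rgt z))"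
abbreviation recursive3 :: "(nat \<Rightarrow> nat \<Rightarrow> nat \<Rightarrow> nat) \<Rightarrow> bool" where
  "recursive3 f \<equiv> recursive (\<lambda>z. f (lft z) (lft (rgt z)) (rgt (rgt z)))"
abbreviation decidable :: "(nat \<Rightarrow> bool) \<Rightarrow> bool" where
  "decidable P \<equiv> recursive (\<lambda>x. of_bool (P x))"
abbreviation decidable2 :: "(nat \<Rightarrow> nat \<Rightarrow> bool) \<Rightarrow> bool" where
  "decidable2 P \<equiv> recursive (\<lambda>z. of_bool (P (lft z) (rgt z)))"

named_theorems rec_intros

lemma pair_lft_rgt [simp]: "pair (lft z) (rgt z) = z"
  by (metis prod.collapse prod_decode_inverse)

lemma computesD: "computes e B f \<Longrightarrow> \<exists>Q. run B e n (f n) Q"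
  by (simp add: computes_def)

lemma recursive_comp: "recursive f \<Longrightarrow> recursive g \<Longrightarrow> recursive (\<lambda>x. f (g x))"
  unfolding recursive_def computes_def by (meson run_comp)

lemma recursive_id [rec_intros]: "recursive (\<lambda>x. x)"
proof -
  have "run {} (PPair PFst PSnd) n n ({} \<union> {})" for n
    using run_pair[OF run_fst run_snd, of "{}" n] by simp
  then show ?thesis unfolding recursive_def computes_def by blast
qed

lemma recursive_Suc [rec_intros]: "recursive f \<Longrightarrow> recursive (\<lambda>x. Suc (f x))"
  by (rule recursive_comp) (auto simp: recursive_def computes_def intro: run_succ)

lemma recursive_const [rec_intros]: "recursive (\<lambda>x. c)"
  by (induction c) (auto simp: recursive_def[of "\<lambda>x. 0"] computes_def intro: run_zero recursive_Suc)

lemma recursive_lft [rec_intros]: "recursive f \<Longrightarrow> recursive (\<lambda>x. lft (f x))"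
  by (rule recursive_comp) (auto simp: recursive_def computes_def intro: run_fst)

lemma recursive_rgt [rec_intros]: "recursive f \<Longrightarrow> recursive (\<lambda>x. rgt (f x))"
  by (rule recursive_comp) (auto simp: recursive_def computes_def intro: run_snd)

lemma recursive_pair [rec_intros]:
  "recursive f \<Longrightarrow> recursive g \<Longrightarrow> recursive (\<lambda>x. pair (f x) (g x))"
  unfolding recursive_def computes_def by (meson run_pair)

lemma recursive2_comp:
  "recursive2 f \<Longrightarrow> recursive a \<Longrightarrow> recursive b \<Longrightarrow> recursive (\<lambda>x. f (a x) (b x))"
  using recursive_comp[of "\<lambda>z. f (lft z) (rgt z)" "\<lambda>x. pair (a x) (b x)"] recursive_pair by simp

lemma recursive3_comp:
  "recursive3 f \<Longrightarrow> recursive a \<Longrightarrow> recursive b \<Longrightarrow> recursive c \<Longrightarrow>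
    recursive (\<lambda>x. f (a x) (b x) (c x))"
  using recursive_comp[of "\<lambda>z. f (lft z) (lft (rgt z)) (rgt (rgt z))"
      "\<lambda>x. pair (a x) (pair (b x) (c x))"] recursive_pair by simp

lemma recursive_rec_nat [rec_intros]:
  assumes "recursive a" "recursive3 g" "recursive n"
  shows "recursive (\<lambda>x. rec_nat (a x) (\<lambda>k y. g x k y) (n x))"
proof -
  obtain ea eg where ea: "\<And>x. \<exists>Q. run {} ea x (a x) Q"
    and eg: "\<And>z. \<exists>Q. run {} eg z (g (lft z) (lft (rgt z)) (rgt (rgt z))) Q"
    using assms(1,2) unfolding recursive_def computes_def by blast
  have "\<exists>Q. run {} (PRec ea eg) (pair x m) (rec_nat (a x) (\<lambda>k y. g x k y) m) Q" for x m
  proof (induction m)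
    case 0
    then show ?case using ea run_rec_0 by fastforce
  next
    case (Suc m)
    then show ?case using eg[of "pair x (pair m (rec_nat (a x) (g x) m))"] run_rec_Suc by fastforce
  qed
  from this[of "lft z" "rgt z" for z]
  have "recursive (\<lambda>z. rec_nat (a (lft z)) (\<lambda>k y. g (lft z) k y) (rgt z))"
    unfolding recursive_def computes_def by auto
  then show ?thesis
    using recursive2_comp[of "\<lambda>x m. rec_nat (a x) (\<lambda>k y. g x k y) m" "\<lambda>x. x" n]
      recursive_id assms(3) by simp
qed

section \<open>Arithmetic by primitive recursion\<close>

lemma recursive_add [rec_intros]:
  assumes "recursive f" "recursive g" shows "recursive (\<lambda>x. f x + g x)"
proof -
  have "rec_nat a (\<lambda>k y. Suc y) b = a + b" for a b by (induction b) auto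
  moreover have "recursive (\<lambda>x. rec_nat (f x) (\<lambda>k y. Suc y) (g x))"
    by (intro rec_intros assms)
  ultimately show ?thesis by simp
qed

lemma recursive_pred:
  assumes "recursive f" shows "recursive (\<lambda>x. f x - 1)"
proof -
  have "rec_nat 0 (\<lambda>k y. k) b = b - 1" for b by (cases b) auto
  moreover have "recursive (\<lambda>x. rec_nat 0 (\<lambda>k y. k) (f x))"
    by (intro rec_intros assms)
  ultimately show ?thesis by simp
qed

lemma recursive_diff [rec_intros]:
  assumes "recursive f" "recursive g" shows "recursive (\<lambda>x. f x - g x)"
proof -
  have "rec_nat a (\<lambda>k y. y - 1) b = a - b" for a b :: nat by (induction b) auto
  moreover have "recursive (\<lambda>x. rec_nat (f x) (\<lambda>k y. y - 1) (g x))"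
    by (intro rec_intros assms recursive_pred)
  ultimately show ?thesis by simp
qed

lemma recursive_mult [rec_intros]:
  assumes "recursive f" "recursive g" shows "recursive (\<lambda>x. f x * g x)"
proof -
  have "rec_nat 0 (\<lambda>k y. y + a) b = a * b" for a b :: nat by (induction b) auto
  moreover have "recursive (\<lambda>x. rec_nat 0 (\<lambda>k y. y + f x) (g x))"
    by (intro rec_intros assms recursive_comp[OF assms(1)])
  ultimately show ?thesis by simp
qed

lemma recursive_power [rec_intros]:
  assumes "recursive f" "recursive g" shows "recursive (\<lambda>x. f x ^ g x)"
proof -
  have "rec_nat 1 (\<lambda>k y. y * a) b = a ^ b" for a b :: nat by (induction b) auto
  moreover have "recursive (\<lambda>x. rec_nat 1 (\<lambda>k y. y * f x) (g x))"
    by (intro rec_intros assms recursive_comp[OF assms(1)])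
  ultimately show ?thesis by simp
qed

section \<open>Decidable predicates, bounded quantifiers and unbounded search\<close>

lemma decidable_not [rec_intros]:
  assumes "decidable P" shows "decidable (\<lambda>x. \<not> P x)"
proof -
  have "of_bool (\<not> P x) = 1 - (of_bool (P x) :: nat)" for x by auto
  then show ?thesis using recursive_diff[OF recursive_const assms, of 1] by simp
qed

lemma decidable_conj [rec_intros]:
  assumes "decidable P" "decidable Q" shows "decidable (\<lambda>x. P x \<and> Q x)"
  using recursive_mult[OF assms] by (simp add: of_bool_conj)

lemma decidable_disj [rec_intros]:
  assumes "decidable P" "decidable Q" shows "decidable (\<lambda>x. P x \<or> Q x)"
  using decidable_not[OF decidable_conj[OF decidable_not[OF assms(1)] decidable_not[OF assms(2)]]]
  by simp

lemma decidable_less [rec_intros]: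
  assumes "recursive f" "recursive g" shows "decidable (\<lambda>x. f x < g x)"
proof -
  have "of_bool (f x < g x) = 1 - (1 - (g x - f x))" for x by auto
  moreover have "recursive (\<lambda>x. 1 - (1 - (g x - f x)))" by (intro rec_intros assms)
  ultimately show ?thesis by simp
qed

lemma decidable_le [rec_intros]:
  assumes "recursive f" "recursive g" shows "decidable (\<lambda>x. f x \<le> g x)"
  using decidable_not[OF decidable_less[OF assms(2,1)]] by (simp add: not_less)

lemma decidable_eq [rec_intros]:
  assumes "recursive f" "recursive g" shows "decidable (\<lambda>x. f x = g x)"
  using decidable_conj[OF decidable_le[OF assms] decidable_le[OF assms(2,1)]]
  by (simp add: eq_iff[symmetric])

lemma recursive_if [rec_intros]:
  assumes "decidable P" "recursive f" "recursive g"
  shows "recursive (\<lambda>x. if P x then f x else g x)"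
proof -
  have "(if P x then f x else g x) = of_bool (P x) * f x + of_bool (\<not> P x) * g x" for x by simp
  moreover have "recursive (\<lambda>x. of_bool (P x) * f x + of_bool (\<not> P x) * g x)"
    by (intro rec_intros assms)
  ultimately show ?thesis by simp
qed

lemma recursive_sum [rec_intros]:
  assumes "recursive2 f" "recursive n" shows "recursive (\<lambda>x. \<Sum>i<n x. f x i)"
proof -
  have "rec_nat 0 (\<lambda>k y. y + f x k) m = (\<Sum>i<m. f x i)" for x m by (induction m) auto
  moreover have "recursive (\<lambda>x. rec_nat 0 (\<lambda>k y. y + f x k) (n x))"
    by (intro rec_intros assms recursive2_comp[OF assms(1)])
  ultimately show ?thesis by simp
qed

lemma decidable_ex [rec_intros]:
  assumes "decidable2 P" "recursive n" shows "decidable (\<lambda>x. \<exists>i<n x. P x i)"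
proof -
  have "of_bool (\<exists>i<n x. P x i) = (of_bool (0 < (\<Sum>i<n x. of_bool (P x i) :: nat)) :: nat)" for x
    by (auto simp: sum_eq_0_iff intro!: sum_pos2)
  then show ?thesis
    using decidable_less[OF recursive_const recursive_sum[OF assms], of 0] by simp
qed

lemma decidable_all [rec_intros]:
  assumes "decidable2 P" "recursive n" shows "decidable (\<lambda>x. \<forall>i<n x. P x i)"
  using decidable_not[OF decidable_ex[OF decidable_not[OF assms(1)] assms(2)]] by simp

lemma recursive_Least [rec_intros]:
  assumes "decidable2 P" "\<And>x. \<exists>n. P x n" shows "recursive (\<lambda>x. LEAST n. P x n)"
proof -
  \<comment> \<open>\<open>PMin\<close> stops at the value 0, hence the negated predicate.\<close>
  obtain e where e: "\<And>z. \<exists>Q. run {} e z (of_bool (\<not> P (lft z) (rgt z))) Q"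
    using decidable_not[OF assms(1)] unfolding recursive_def computes_def by blast
  have "\<exists>Q. run {} (PMin e) x (LEAST n. P x n) Q" for x
  proof -
    let ?n = "LEAST n. P x n"
    have n: "P x ?n" using assms(2) by (rule LeastI_ex)
    obtain R where R: "\<And>i. run {} e (pair x i) (of_bool (\<not> P x i)) (R i)"
      using e[of "pair x i" for i] by simp metis
    have "run {} e (pair x i) (Suc 0) (R i)" if "i < ?n" for i
      using R[of i] not_less_Least[OF that] by simp
    moreover have "run {} e (pair x ?n) 0 (R ?n)" using R[of ?n] n by simp
    ultimately show ?thesis using run_min[of ?n "{}" e x "\<lambda>_. 0" R] by auto
  qed
  then show ?thesis unfolding recursive_def computes_def by blast
qed

lemma recursive_div [rec_intros]:
  assumes "recursive f" "recursive g" shows "recursive (\<lambda>x. f x div g x)"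
proof -
  \<comment> \<open>The disjunct \<open>b = 0\<close> makes the search succeed for every argument,
    as \<open>recursive_Least\<close> demands.\<close>
  have *: "a div b = (if b = 0 then 0 else LEAST q. a < Suc q * b \<or> b = 0)" for a b :: nat
  proof (cases "b = 0")
    case False
    have "(LEAST q. a < Suc q * b) = a div b"
    proof (rule Least_equality)
      show "a < Suc (a div b) * b" using False
        by (metis dividend_less_times_div mult.commute mult_Suc neq0_conv)
      show "a div b \<le> y" if "a < Suc y * b" for y
        using less_mult_imp_div_less[OF that] by simp
    qed
    then show ?thesis using False by simp
  qed simp
  have "\<exists>q. a < Suc q * b \<or> b = 0" for a b :: nat
    by (metis dividend_less_times_div mult.commute mult_Suc neq0_conv)
  then show ?thesis unfolding *[of "f _"]
    by (intro rec_intros assms recursive_comp[OF assms(1)] recursive_comp[OF assms(2)])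
qed

lemma recursive_mod [rec_intros]:
  assumes "recursive f" "recursive g" shows "recursive (\<lambda>x. f x mod g x)"
  using assms unfolding modulo_nat_def by (intro rec_intros)

lemma decidable_odd [rec_intros]:
  assumes "recursive f" shows "decidable (\<lambda>x. odd (f x))"
  unfolding odd_iff_mod_2_eq_one using assms by (intro rec_intros)

text \<open>Builds finitely many values of an arbitrary \<open>f\<close> into a program. Reductions
  and traces use it for the arguments before a threshold.\<close>

lemma recursive_finite_table: "recursive (\<lambda>x. if x < n then f x else 0)"
proof (induction n)
  case (Suc n)
  have "(if x < Suc n then f x else 0) = (if x = n then f n else if x < n then f x else 0)" for x
    by auto
  moreover have "recursive (\<lambda>x. if x = n then f n else if x < n then f x else 0)"
    by (intro rec_intros Suc)
  ultimately show ?case by simp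
qed (simp add: recursive_const)

text \<open>The summand \<open>n\<close> makes the majorant unbounded; the sum up to
  \<open>n\<close> makes it monotone and at least \<open>r n\<close>.\<close>

lemma order_majorant:
  assumes "recursive r" obtains r' where "order_function r'" "\<And>n. r n \<le> r' n"
proof
  let ?r = "\<lambda>n. n + (\<Sum>i<Suc n. r i)"
  have "n \<le> ?r n" for n by simp
  then have "\<not> bdd_above (range ?r)"
    unfolding bdd_above_def by (metis Suc_n_not_le_n le_trans rangeI)
  moreover have "mono ?r"
    unfolding mono_iff_le_Suc by simp
  moreover have "recursive ?r"
    by (intro rec_intros recursive_comp[OF assms])
  ultimately show "order_function ?r" unfolding order_function_def by blast
  show "r n \<le> ?r n" for n by (simp add: trans_le_add2)
qed

lemma order_function_unbounded: "order_function h \<Longrightarrow> \<exists>x. y \<le> h x"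
  unfolding order_function_def bdd_above_def by (metis linear rangeE)

section \<open>Bounded evaluation of programs\<close>

definition str_len :: "nat \<Rightarrow> nat" where
  "str_len w = (LEAST l. w + 1 < 2 ^ Suc l)"

lemma str_len_ex: "\<exists>l. w + 1 < (2::nat) ^ Suc l"
proof
  have "w < 2 ^ w" by (rule less_exp)
  then have "w + 1 < 2 * 2 ^ w" by linarith
  then show "w + 1 < 2 ^ Suc w" by simp
qed

lemma str_len_unique:
  assumes "2 ^ l \<le> w + 1" "w + 1 < 2 ^ Suc l" shows "str_len w = l"
  unfolding str_len_def
proof (rule Least_equality)
  show "l \<le> y" if "w + 1 < 2 ^ Suc y" for y
  proof -
    have "(2::nat) ^ l < 2 ^ Suc y" using assms(1) that by linarith
    then show ?thesis using power_strict_increasing_iff[of "2::nat" l "Suc y"] by simp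
  qed
qed (fact assms)

text \<open>In binary, \<open>nat_of_str \<sigma> + 1\<close> is the digit 1 followed by the bits of
  \<open>\<sigma>\<close>.\<close>

lemma nat_of_str_bounds:
  "2 ^ length \<sigma> \<le> nat_of_str \<sigma> + 1 \<and> nat_of_str \<sigma> + 1 < 2 ^ Suc (length \<sigma>)"
  by (induction \<sigma> rule: rev_induct) (auto simp: nat_of_str_snoc, auto simp: nat_of_str_def)

lemma str_len_nat_of_str [simp]: "str_len (nat_of_str \<sigma>) = length \<sigma>"
  using nat_of_str_bounds str_len_unique by blast

lemma nat_of_str_of_nat [simp]: "nat_of_str (str_of_nat w) = w"
  unfolding str_of_nat_def using bij_nat_of_str by (simp add: bij_is_surj surj_f_inv_f)

lemma str_of_nat_of_str [simp]: "str_of_nat (nat_of_str \<sigma>) = \<sigma>"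
  unfolding str_of_nat_def using bij_nat_of_str by (simp add: bij_is_inj)

lemma length_str_of_nat [simp]: "length (str_of_nat w) = str_len w"
  by (metis nat_of_str_of_nat str_len_nat_of_str)

lemma str_len_bounds: "2 ^ str_len w \<le> w + 1" "w + 1 < 2 ^ Suc (str_len w)"
  using nat_of_str_bounds[of "str_of_nat w"] by simp_all

lemma str_len_le_iff: "str_len w \<le> n \<longleftrightarrow> w + 1 < 2 ^ Suc n"
proof
  assume "str_len w \<le> n"
  then have "(2::nat) ^ Suc (str_len w) \<le> 2 ^ Suc n" by (intro power_increasing) auto
  then show "w + 1 < 2 ^ Suc n" using str_len_bounds(2)[of w] by linarith
qed (auto simp: str_len_def intro: Least_le)

definition code :: "nat set \<Rightarrow> nat \<Rightarrow> nat" where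
  "code A n = nat_of_str (initial_segment A n)"

lemma code_0 [simp]: "code A 0 = 0"
  by (simp add: code_def initial_segment_def nat_of_str_def)

lemma code_Suc: "code A (Suc n) = 2 * code A n + 1 + of_bool (n \<in> A)"
  by (simp add: code_def initial_segment_def nat_of_str_snoc)

lemma str_len_code [simp]: "str_len (code A n) = n"
  by (simp add: code_def initial_segment_def)

lemma initial_segment_eq: "initial_segment A n = str_of_nat (code A n)"
  by (simp add: code_def)

lemma code_empty: "code {} n = 2 ^ n - 1"
proof -
  have "code {} n + 1 = 2 ^ n" by (induction n) (auto simp: code_Suc)
  then show ?thesis by simp
qed

lemma code_cong: "(\<And>x. x < n \<Longrightarrow> x \<in> A \<longleftrightarrow> x \<in> B) \<Longrightarrow> code A n = code B n"
  by (induction n) (auto simp: code_Suc)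

text \<open>The bits of the string numbered \<open>w\<close> are the binary digits of
  \<open>w + 1\<close> below the leading 1. Positions beyond the end count as non-members, so a
  string acts as a finite oracle.\<close>

definition smem :: "nat \<Rightarrow> nat \<Rightarrow> bool" where
  "smem w x \<longleftrightarrow> x < str_len w \<and> odd ((w + 1) div 2 ^ (str_len w - 1 - x))"

abbreviation sset :: "nat \<Rightarrow> nat set" where "sset w \<equiv> {x. smem w x}"

text \<open>Halving \<open>code A n + 1\<close> deletes the last bit of the string.\<close>

lemma code_div: "(code A (m + d) + 1) div 2 ^ d = code A m + 1"
proof (induction d)
  case (Suc d)
  have "(code A (m + Suc d) + 1) div 2 ^ Suc d = (code A (Suc (m + d)) + 1) div 2 div 2 ^ d"
    by (simp add: div_mult2_eq)
  also have "(code A (Suc (m + d)) + 1) div 2 = code A (m + d) + 1"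
    by (simp add: code_Suc)
  finally show ?case using Suc by simp
qed simp

lemma smem_code: "smem (code A n) x \<longleftrightarrow> x < n \<and> x \<in> A"
proof (cases "x < n")
  case True
  then have "(code A n + 1) div 2 ^ (n - 1 - x) = code A (Suc x) + 1"
    using code_div[of A "Suc x" "n - 1 - x"] by simp
  then show ?thesis using True by (auto simp: smem_def code_Suc)
qed (simp add: smem_def)

lemma recursive_str_len [rec_intros]:
  assumes "recursive f" shows "recursive (\<lambda>x. str_len (f x))"
  unfolding str_len_def
  by (intro rec_intros assms recursive_comp[OF assms] str_len_ex)

lemma decidable_smem [rec_intros]:
  assumes "recursive f" "recursive g" shows "decidable (\<lambda>x. smem (f x) (g x))"
  unfolding smem_def by (intro rec_intros assms)

lemma recursive_code [rec_intros]:
  assumes "decidable2 P" "recursive n" shows "recursive (\<lambda>x. code {i. P x i} (n x))"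
proof -
  have *: "code X m = rec_nat 0 (\<lambda>k y. 2 * y + 1 + of_bool (k \<in> X)) m" for X m
    by (induction m) (auto simp: code_Suc)
  show ?thesis unfolding * mem_Collect_eq
    by (intro rec_intros assms recursive2_comp[OF assms(1)])
qed

text \<open>
  \<open>ev e w t x\<close> runs \<open>e\<close> on input \<open>x\<close> with the string \<open>w\<close> as oracle and with every unbounded search
  stopped at \<open>t\<close>. The result is \<open>0\<close> if a search was stopped and \<open>Suc y\<close> if the output is \<open>y\<close>.
\<close>

primrec ev :: "prog \<Rightarrow> nat \<Rightarrow> nat \<Rightarrow> nat \<Rightarrow> nat" where
  "ev PZero w t x = 1"
| "ev PSucc w t x = Suc (Suc x)"
| "ev PFst w t x = Suc (lft x)"
| "ev PSnd w t x = Suc (rgt x)"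
| "ev PQuery w t x = Suc (of_bool (smem w x))"
| "ev (PPair f g) w t x =
    (if ev f w t x = 0 \<or> ev g w t x = 0 then 0 else Suc (pair (ev f w t x - 1) (ev g w t x - 1)))"
| "ev (PComp f g) w t x = (if ev g w t x = 0 then 0 else ev f w t (ev g w t x - 1))"
| "ev (PRec f g) w t x = rec_nat (ev f w t (lft x))
    (\<lambda>n r. if r = 0 then 0 else ev g w t (pair (lft x) (pair n (r - 1)))) (rgt x)"
| "ev (PMin f) w t x =
    (if \<exists>n<t. ev f w t (pair x n) = 1 \<and> (\<forall>i<n. 1 < ev f w t (pair x i))
     then Suc (LEAST n. n = t \<or> ev f w t (pair x n) = 1) else 0)"

lemma recursive_ev: "recursive3 (ev e)"
proof (induction e)
  case (PPair f g)
  then show ?case unfolding ev.simps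
    by (intro rec_intros recursive3_comp[OF PPair.IH(1)] recursive3_comp[OF PPair.IH(2)])
next
  case (PComp f g)
  then show ?case unfolding ev.simps
    by (intro rec_intros recursive3_comp[OF PComp.IH(1)] recursive3_comp[OF PComp.IH(2)])
next
  case (PRec f g)
  then show ?case unfolding ev.simps
    by (intro rec_intros recursive3_comp[OF PRec.IH(1)] recursive3_comp[OF PRec.IH(2)])
next
  case (PMin f)
  \<comment> \<open>The disjunct \<open>n = t\<close> in the clause for \<open>PMin\<close> makes
    the search for the least \<open>n\<close> total.\<close>
  have "\<exists>n. n = t \<or> P n" for t :: nat and P by blast
  then show ?case unfolding ev.simps
    by (intro rec_intros recursive3_comp[OF PMin.IH])
qed (unfold ev.simps, (intro rec_intros)+)

lemma ev_sound: "ev e w t x = Suc y \<Longrightarrow> \<exists>Q. run (sset w) e x y Q"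
proof (induction e arbitrary: x y)
  case PZero
  then show ?case using run_zero by auto
next
  case PSucc
  then show ?case using run_succ by auto
next
  case PFst
  then show ?case using run_fst by auto
next
  case PSnd
  then show ?case using run_snd by auto
next
  case PQuery
  then show ?case using run_query[of "sset w" x] by auto
next
  case (PPair f g)
  then obtain u v where uv: "ev f w t x = Suc u" "ev g w t x = Suc v"
    by (cases "ev f w t x"; cases "ev g w t x") auto
  then have "y = pair u v" using PPair.prems by simp
  then show ?case using PPair.IH(1)[OF uv(1)] PPair.IH(2)[OF uv(2)] run_pair by blast
next
  case (PComp f g)
  then obtain u where u: "ev g w t x = Suc u" by (cases "ev g w t x") auto
  then have "ev f w t u = Suc y" using PComp.prems by simp
  then show ?case using PComp.IH(1) PComp.IH(2)[OF u] run_comp by blast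
next
  case (PRec f g)
  define F where "F = rec_nat (ev f w t (lft x))
    (\<lambda>n r. if r = 0 then 0 else ev g w t (pair (lft x) (pair n (r - 1))))"
  have "F n = Suc y \<Longrightarrow> \<exists>Q. run (sset w) (PRec f g) (pair (lft x) n) y Q" for n y
  proof (induction n arbitrary: y)
    case 0
    then show ?case using PRec.IH(1)[of "lft x" y] run_rec_0 by (fastforce simp: F_def)
  next
    case (Suc n)
    then obtain z where z: "F n = Suc z" by (cases "F n") (auto simp: F_def)
    then have "ev g w t (pair (lft x) (pair n z)) = Suc y" using Suc.prems by (simp add: F_def)
    then show ?case using PRec.IH(2) Suc.IH[OF z] run_rec_Suc by meson
  qed
  from this[of "rgt x" y] show ?case using PRec.prems by (simp add: F_def)
next
  case (PMin f)
  then obtain n where n: "n < t" "ev f w t (pair x n) = 1" "\<forall>i<n. 1 < ev f w t (pair x i)"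
    and y: "y = (LEAST n. n = t \<or> ev f w t (pair x n) = 1)"
    by (auto split: if_splits)
  have "y = n" unfolding y
    by (rule Least_equality) (use n in \<open>force simp: not_le[symmetric]\<close>)+
  obtain R where R: "\<And>i v. ev f w t (pair x i) = Suc v \<Longrightarrow> run (sset w) f (pair x i) v (R i)"
  proof -
    have "\<exists>Q. \<forall>v. ev f w t (pair x i) = Suc v \<longrightarrow> run (sset w) f (pair x i) v Q" for i
      using PMin.IH by (cases "ev f w t (pair x i)") auto
    then show ?thesis using that by metis
  qed
  \<comment> \<open>\<open>ev\<close> adds one to the output, and the output itself is positive
    before the search ends; hence the subtraction of 2.\<close>
  have "run (sset w) f (pair x i) (Suc (ev f w t (pair x i) - 2)) (R i)" if "i < n" for i
    using n(3) that by (intro R) auto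
  moreover have "run (sset w) f (pair x n) 0 (R n)" using n(2) by (intro R) auto
  ultimately have "run (sset w) (PMin f) x n (\<Union>i\<le>n. R i)"
    by (rule run_min[where v="\<lambda>i. ev f w t (pair x i) - 2"])
  then show ?case using \<open>y = n\<close> by blast
qed

lemma ev_PRec_Suc: "ev (PRec f g) w t (pair a (Suc n)) =
    (if ev (PRec f g) w t (pair a n) = 0 then 0
     else ev g w t (pair a (pair n (ev (PRec f g) w t (pair a n) - 1))))"
  by (simp cong: if_cong)

text \<open>A halting run consists of finitely many subcomputations, so one bound on searches serves
  all of them. Claiming the value for all large \<open>t\<close> lets the bounds be combined by
  maxima and sums.\<close>

lemma ev_complete: "run (sset w) e x y Q \<Longrightarrow> \<exists>t0. \<forall>t\<ge>t0. ev e w t x = Suc y"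
proof (induction rule: run.induct)
  case (run_pair f x y Q g z R)
  then obtain t1 t2 where "\<forall>t\<ge>t1. ev f w t x = Suc y" "\<forall>t\<ge>t2. ev g w t x = Suc z" by blast
  then show ?case by (intro exI[of _ "max t1 t2"]) simp
next
  case (run_comp g x y Q f z R)
  then obtain t1 t2 where "\<forall>t\<ge>t1. ev g w t x = Suc y" "\<forall>t\<ge>t2. ev f w t y = Suc z" by blast
  then show ?case by (intro exI[of _ "max t1 t2"]) simp
next
  case (run_rec_Suc f g a n y Q z R)
  then obtain t1 t2 where "\<forall>t\<ge>t1. ev (PRec f g) w t (pair a n) = Suc y"
    "\<forall>t\<ge>t2. ev g w t (pair a (pair n y)) = Suc z" by blast
  then show ?case
    by (intro exI[of _ "max t1 t2"]) (simp add: ev_PRec_Suc del: ev.simps(8))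
next
  case (run_min n f x v R)
  then have "\<forall>i. \<exists>t0. i < n \<longrightarrow> (\<forall>t\<ge>t0. ev f w t (pair x i) = Suc (Suc (v i)))" by blast
  then obtain T where T: "\<And>i t. i < n \<Longrightarrow> T i \<le> t \<Longrightarrow> ev f w t (pair x i) = Suc (Suc (v i))"
    by metis
  obtain t1 where t1: "\<forall>t\<ge>t1. ev f w t (pair x n) = Suc 0" using run_min.IH by auto
  \<comment> \<open>Large enough for every value up to \<open>n\<close> to have settled, and above
    \<open>n\<close> so that the search itself is not stopped.\<close>
  let ?t0 = "Suc n + t1 + (\<Sum>i<n. T i)"
  have "ev (PMin f) w t x = Suc n" if t: "t \<ge> ?t0" for t
  proof -
    have *: "ev f w t (pair x i) = Suc (Suc (v i))" if "i < n" for i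
    proof -
      have "T i \<le> (\<Sum>i<n. T i)" using that by (intro member_le_sum) auto
      then show ?thesis using T[OF that] t by simp
    qed
    have **: "ev f w t (pair x n) = 1" using t1 t by simp
    have "(LEAST n. n = t \<or> ev f w t (pair x n) = 1) = n"
    proof (rule Least_equality)
      show "n \<le> y" if "y = t \<or> ev f w t (pair x y) = 1" for y
        using that *[of y] t by (cases "y < n") auto
    qed (simp add: **)
    moreover have "\<exists>n<t. ev f w t (pair x n) = 1 \<and> (\<forall>i<n. 1 < ev f w t (pair x i))"
      using * ** t by (intro exI[of _ n]) simp
    ultimately show ?thesis by (simp only: ev.simps if_True)
  qed
  then show ?case by blast
qed (auto simp: of_bool_def)

text \<open>
  The clause \<open>y \<le> t\<close> makes a halting time an upper bound of the output.
\<close>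

definition stage_function :: "(nat \<Rightarrow> nat \<Rightarrow> nat) \<Rightarrow> (nat \<Rightarrow> nat option) \<Rightarrow> bool" where
  "stage_function s \<psi> \<longleftrightarrow> recursive2 s \<and> (\<forall>t x y. s t x = Suc y \<longrightarrow> \<psi> x = Some y \<and> y \<le> t) \<and>
    (\<forall>x y. \<psi> x = Some y \<longrightarrow> (\<exists>t0. \<forall>t\<ge>t0. s t x = Suc y))"

lemma smem_0 [simp]: "\<not> smem 0 x"
  using smem_code[of "{}" 0] by simp

lemma partial_recursive_stage:
  assumes "partial_recursive \<psi>" obtains s where "stage_function s \<psi>"
proof -
  obtain e where e: "\<And>x y. \<psi> x = Some y \<longleftrightarrow> (\<exists>Q. run {} e x y Q)"
    using assms unfolding partial_recursive_def by blast
  \<comment> \<open>The number 0 is the empty string, that is, the empty oracle. Results exceeding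
    \<open>Suc t\<close> are withheld in order to get \<open>y \<le> t\<close>.\<close>
  let ?s = "\<lambda>t x. if ev e 0 t x \<le> Suc t then ev e 0 t x else 0"
  have "recursive2 ?s"
    by (intro rec_intros recursive3_comp[OF recursive_ev[of e]])
  moreover have "\<psi> x = Some y \<and> y \<le> t" if "?s t x = Suc y" for t x y
    using ev_sound[of e 0 t x y] that e by (auto split: if_splits)
  moreover have "\<exists>t0. \<forall>t\<ge>t0. ?s t x = Suc y" if "\<psi> x = Some y" for x y
  proof -
    obtain Q where "run (sset 0) e x y Q" using \<open>\<psi> x = Some y\<close> e by auto
    then obtain t0 where "\<forall>t\<ge>t0. ev e 0 t x = Suc y" using ev_complete by blast
    then show ?thesis by (intro exI[of _ "max t0 y"]) auto
  qed
  ultimately have "stage_function ?s \<psi>"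
    unfolding stage_function_def by (intro conjI allI impI) blast+
  then show ?thesis by (rule that)
qed

text \<open>Search for the first stage with a nonzero value and take the predecessor of that
  value.\<close>

lemma partial_recursiveI:
  assumes "recursive2 s"
    and "\<And>t x y. s t x = Suc y \<Longrightarrow> \<psi> x = Some y"
    and "\<And>x y. \<psi> x = Some y \<Longrightarrow> \<exists>t. s t x = Suc y"
  shows "partial_recursive \<psi>"
proof -
  have "recursive (\<lambda>z. 1 - s (rgt z) (lft z))" "recursive (\<lambda>z. s (lft z) (rgt z) - 1)"
    by (intro rec_intros recursive2_comp[OF assms(1)])+
  then obtain e1 e2 where
    e1: "\<And>x t. \<exists>Q. run {} e1 (pair x t) (1 - s t x) Q" and
    e2: "\<And>x t. \<exists>Q. run {} e2 (pair t x) (s t x - 1) Q"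
    unfolding recursive_def computes_def by (metis fst_conv prod_encode_inverse snd_conv)
  \<comment> \<open>\<open>PMin e1\<close> finds the first stage, as \<open>e1\<close> computes
    \<open>1 - s t x\<close>; \<open>PPair PFst PSnd\<close> is the identity and hands on the
    input.\<close>
  let ?e = "PComp e2 (PPair (PMin e1) (PPair PFst PSnd))"
  have id: "\<exists>Q. run {} (PPair PFst PSnd) x x Q" for x
    using run_pair[OF run_fst run_snd, of "{}" x] by auto
  have conv: "\<exists>y Q. \<psi> x = Some y \<and> run {} ?e x y Q" if "\<exists>t. s t x \<noteq> 0" for x
  proof -
    let ?n = "LEAST t. s t x \<noteq> 0"
    have n: "s ?n x \<noteq> 0" using that by (rule LeastI_ex)
    obtain R where R: "\<And>t. run {} e1 (pair x t) (1 - s t x) (R t)" using e1 by metis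
    have "run {} e1 (pair x i) (Suc 0) (R i)" if "i < ?n" for i
      using R[of i] not_less_Least[OF that] by simp
    moreover have "run {} e1 (pair x ?n) 0 (R ?n)" using R[of ?n] n by (cases "s ?n x") auto
    ultimately have "\<exists>Q. run {} (PMin e1) x ?n Q"
      using run_min[of ?n "{}" e1 x "\<lambda>_. 0" R] by blast
    then have "\<exists>Q. run {} ?e x (s ?n x - 1) Q"
      using e2[of ?n x] id[of x] by (meson run_comp run_pair)
    moreover have "\<psi> x = Some (s ?n x - 1)" using assms(2)[of ?n x "s ?n x - 1"] n by simp
    ultimately show ?thesis by blast
  qed
  have "\<psi> x = Some y \<longleftrightarrow> (\<exists>Q. run {} ?e x y Q)" for x y
  proof
    assume "\<psi> x = Some y"
    then obtain t where "s t x = Suc y" using assms(3) by blast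
    then have "\<exists>t. s t x \<noteq> 0" by (intro exI[of _ t]) simp
    then show "\<exists>Q. run {} ?e x y Q" using conv \<open>\<psi> x = Some y\<close> by fastforce
  next
    assume "\<exists>Q. run {} ?e x y Q"
    then obtain Q where Q: "run {} ?e x y Q" ..
    then obtain n Q' where "run {} (PMin e1) x n Q'"
    proof (cases rule: run.cases)
      case (run_comp y Q R)
      from run_comp(2) that show ?thesis by (cases rule: run.cases) auto
    qed
    then obtain Q'' where "run {} e1 (pair x n) 0 Q''" by (cases rule: run.cases) auto
    then have "1 - s n x = 0" using e1[of x n] run_deterministic by blast
    then have "\<exists>t. s t x \<noteq> 0" by (intro exI[of _ n]) simp
    then show "\<psi> x = Some y" using conv[of x] Q run_deterministic by blast
  qed
  then show ?thesis unfolding partial_recursive_def by blast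
qed

section \<open>Replacing the oracle: substitution, query-free programs and the use principle\<close>

primrec qsubst :: "prog \<Rightarrow> prog \<Rightarrow> prog" where
  "qsubst q PZero = PZero"
| "qsubst q PSucc = PSucc"
| "qsubst q PFst = PFst"
| "qsubst q PSnd = PSnd"
| "qsubst q PQuery = q"
| "qsubst q (PPair f g) = PPair (qsubst q f) (qsubst q g)"
| "qsubst q (PComp f g) = PComp (qsubst q f) (qsubst q g)"
| "qsubst q (PRec f g) = PRec (qsubst q f) (qsubst q g)"
| "qsubst q (PMin f) = PMin (qsubst q f)"

text \<open>With a reduction for \<open>q\<close> this composes reductions; with
  \<open>PZero\<close> for \<open>q\<close> it removes the queries to an empty oracle.\<close>

lemma run_qsubst:
  assumes "run X e x y Q" "\<And>z. run B q z (of_bool (z \<in> X)) (R z)"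
  shows "run B (qsubst q e) x y (\<Union>z\<in>Q. R z)"
  using assms(1)
proof (induction rule: run.induct)
  case (run_min n f x v Q)
  then have "run B (PMin (qsubst q f)) x n (\<Union>i\<le>n. \<Union>z\<in>Q i. R z)"
    by (intro run.run_min) auto
  then show ?case by (simp add: UN_UN_flatten)
next
  case (run_query x)
  then show ?case using assms(2)[of x] by simp
qed (auto simp: UN_Un intro: run.intros)

text \<open>A program for a recursive function may still query its empty oracle. Once
  \<open>PZero\<close> answers these queries, it can be built into any reduction without adding to
  the use.\<close>

lemma recursive_query_free:
  assumes "recursive f" obtains e where "\<And>B n. run B e n (f n) {}"
proof -
  obtain e where e: "\<And>n. \<exists>Q. run {} e n (f n) Q"
    using assms unfolding recursive_def computes_def by blast
  have "run B PZero z (of_bool (z \<in> {})) {}" for B z using run_zero by simp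
  from run_qsubst[OF _ this] have "run B (qsubst PZero e) n (f n) {}" for B n
    using e[of n] by fastforce
  then show ?thesis using that by blast
qed

lemma partial_recursive_query_free:
  assumes "partial_recursive \<psi>" obtains e where "\<And>B x y. \<psi> x = Some y \<Longrightarrow> run B e x y {}"
proof -
  obtain e where e: "\<And>x y. \<psi> x = Some y \<Longrightarrow> \<exists>Q. run {} e x y Q"
    using assms unfolding partial_recursive_def by blast
  have "run B PZero z (of_bool (z \<in> {})) {}" for B z using run_zero by simp
  from run_qsubst[OF _ this] have "run B (qsubst PZero e) x y {}" if "\<psi> x = Some y" for B x y
    using e[OF that] by fastforce
  then show ?thesis using that by blast
qed

text \<open>The use principle: a computation depends on the oracle only through the answers to its
  queries.\<close>

lemma run_oracle_cong:
  assumes "run B e x y Q" "\<And>z. z \<in> Q \<Longrightarrow> z \<in> B \<longleftrightarrow> z \<in> C" shows "run C e x y Q"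
  using assms
proof (induction rule: run.induct)
  case (run_query x)
  then show ?case using run.run_query[of C x] by simp
next
  case (run_min n f x v R)
  have "run C f (pair x i) (Suc (v i)) (R i)" if "i < n" for i
    using run_min.IH(1)[OF that] run_min.prems that by (meson UN_I atMost_iff less_imp_le)
  then show ?case using run_min by (intro run.run_min[of n C f x v R]) auto
qed (auto intro: run.intros)

lemma use_fun_le_iff:
  assumes "\<And>m. m < n \<Longrightarrow> \<exists>y Q. run B e m y Q"
  shows "use_fun e B n \<le> k \<longleftrightarrow> (\<forall>m<n. \<forall>q\<in>queries e B m. q < k)"
proof -
  have "finite (queries e B m)" if "m < n" for m
    using assms[OF that] by (auto simp: queries_eq run_finite_queries)
  then have fin: "finite (\<Union>m<n. queries e B m)" by auto
  show ?thesis
  proof (cases "(\<Union>m<n. queries e B m) = {}")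
    case False
    then show ?thesis unfolding use_fun_def Let_def
      using Max_less_iff[OF fin False, of k] by auto
  qed (auto simp: use_fun_def)
qed

section \<open>Complexity in terms of numbers\<close>

lemma eventually_all_less:
  assumes "\<And>m. m < (k::nat) \<Longrightarrow> \<exists>t0. \<forall>t\<ge>t0. P m (t::nat)"
  shows "\<exists>t0. \<forall>t\<ge>t0. \<forall>m<k. P m t"
proof -
  have "\<forall>\<^sub>F t in sequentially. \<forall>m\<in>{..<k}. P m t"
    using assms by (intro eventually_ball_finite) (auto simp: eventually_sequentially)
  then show ?thesis by (auto simp: eventually_sequentially)
qed

lemma ev_unique: "ev e w t x = Suc y \<Longrightarrow> ev e w t' x = Suc y' \<Longrightarrow> y = y'"
  by (meson ev_sound run_deterministic)

lemma ev_oracle_agrees: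
  assumes "computes e B f" "\<And>q. q \<in> queries e B m \<Longrightarrow> smem d q \<longleftrightarrow> q \<in> B"
  shows "\<exists>t0. \<forall>t\<ge>t0. ev e d t m = Suc (f m)"
proof -
  obtain Q where Q: "run B e m (f m) Q" using assms(1) computesD by blast
  then have "run (sset d) e m (f m) Q"
    using assms(2) queries_eq[OF Q] by (intro run_oracle_cong[OF Q]) auto
  then show ?thesis by (rule ev_complete)
qed

lemma stage_function_unique:
  "stage_function s \<psi> \<Longrightarrow> s t x = Suc y \<Longrightarrow> s t' x = Suc y' \<Longrightarrow> y = y'"
  unfolding stage_function_def by (metis option.inject)

text \<open>Lets a machine be given by a recursive approximation alone, provided that no input ever
  receives two different values.\<close>

lemma partial_recursive_of_stages:
  assumes "recursive2 s" "\<And>t t' x y y'. s t x = Suc y \<Longrightarrow> s t' x = Suc y' \<Longrightarrow> y = y'"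
  obtains \<psi> where "partial_recursive \<psi>" "\<And>x y. \<psi> x = Some y \<longleftrightarrow> (\<exists>t. s t x = Suc y)"
proof -
  let ?\<psi> = "\<lambda>x. if \<exists>t y. s t x = Suc y then Some (THE y. \<exists>t. s t x = Suc y) else None"
  have eq: "?\<psi> x = Some y \<longleftrightarrow> (\<exists>t. s t x = Suc y)" for x y
  proof -
    have "(THE y. \<exists>t. s t x = Suc y) = z" if "s t x = Suc z" for t z
      using that assms(2) by (intro the_equality) blast+
    then show ?thesis by auto
  qed
  then have "partial_recursive ?\<psi>" by (intro partial_recursiveI[OF assms(1)]) (blast+)
  then show ?thesis using eq by (rule that)
qed

text \<open>The infimum of a nonempty set of extended naturals is attained, and that of the empty
  set is infinite.\<close>

lemma complexity_le_iff: "complexity M \<sigma> \<le> enat n \<longleftrightarrow> (\<exists>\<tau>. M \<tau> = Some \<sigma> \<and> length \<tau> \<le> n)"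
proof
  assume le: "complexity M \<sigma> \<le> enat n"
  let ?S = "(\<lambda>\<tau>. enat (length \<tau>)) ` {\<tau>. M \<tau> = Some \<sigma>}"
  have "?S \<noteq> {}" using le unfolding complexity_def by (auto simp: Inf_enat_def split: if_splits)
  then have "Inf ?S \<in> ?S" by (auto simp: Inf_enat_def intro: LeastI)
  then show "\<exists>\<tau>. M \<tau> = Some \<sigma> \<and> length \<tau> \<le> n"
    using le unfolding complexity_def by auto
next
  assume "\<exists>\<tau>. M \<tau> = Some \<sigma> \<and> length \<tau> \<le> n"
  then obtain \<tau> where "M \<tau> = Some \<sigma>" "length \<tau> \<le> n" by blast
  then show "complexity M \<sigma> \<le> enat n"
    unfolding complexity_def by (intro INF_lower2[of \<tau>]) auto
qed

definition on_numbers :: "(bool list \<Rightarrow> bool list option) \<Rightarrow> nat \<Rightarrow> nat option" where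
  "on_numbers M j = map_option nat_of_str (M (str_of_nat j))"

definition on_strings :: "(nat \<Rightarrow> nat option) \<Rightarrow> bool list \<Rightarrow> bool list option" where
  "on_strings \<psi> \<tau> = map_option str_of_nat (\<psi> (nat_of_str \<tau>))"

lemma machine_iff: "machine M \<longleftrightarrow> partial_recursive (on_numbers M)"
  unfolding machine_def on_numbers_def ..

lemma on_numbers_on_strings [simp]: "on_numbers (on_strings \<psi>) = \<psi>"
  by (rule ext) (simp add: on_numbers_def on_strings_def option.map_comp o_def option.map_ident)

lemma on_numbers_eq_Some:
  "on_numbers M j = Some w \<longleftrightarrow> M (str_of_nat j) = Some (str_of_nat w)"
  by (auto simp: on_numbers_def)

lemma complexity_le_iff_number:
  "complexity M (str_of_nat w) \<le> enat n \<longleftrightarrow> (\<exists>j. str_len j \<le> n \<and> on_numbers M j = Some w)"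
  unfolding complexity_le_iff on_numbers_eq_Some
  by (metis length_str_of_nat str_of_nat_of_str)

lemma optimal_number:
  assumes "optimal U" "partial_recursive \<psi>"
  obtains c where "\<And>j w. \<psi> j = Some w \<Longrightarrow> complexity U (str_of_nat w) \<le> enat (str_len j + c)"
proof -
  have "machine (on_strings \<psi>)" using assms(2) by (simp add: machine_iff)
  then obtain c where c: "\<And>\<sigma>. complexity U \<sigma> \<le> complexity (on_strings \<psi>) \<sigma> + enat c"
    using assms(1) unfolding optimal_def by blast
  have "complexity U (str_of_nat w) \<le> enat (str_len j + c)" if "\<psi> j = Some w" for j w
  proof -
    have "complexity (on_strings \<psi>) (str_of_nat w) \<le> enat (str_len j)"
      unfolding complexity_le_iff_number using that by auto
    then have "complexity (on_strings \<psi>) (str_of_nat w) + enat c \<le> enat (str_len j) + enat c"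
      by (rule add_right_mono)
    then show ?thesis using c[of "str_of_nat w"] by (simp add: order_trans)
  qed
  then show ?thesis by (rule that)
qed

lemma anti_complexD:
  assumes "anti_complex U A" "order_function f"
  obtains n0 where "\<And>n. n \<ge> n0 \<Longrightarrow> \<exists>j. j + 1 < 2 ^ Suc n \<and> on_numbers U j = Some (code A (f n))"
  using assms unfolding anti_complex_def eventually_sequentially initial_segment_eq
    complexity_le_iff_number str_len_le_iff by blast

text \<open>
  A program of length \<open>n div 2 + 1\<close> carries \<open>i\<close> and the parity of \<open>n\<close>, so that \<open>n\<close> can be recovered from
  the length and the last bit.
\<close>

lemma anti_complexI:
  assumes "optimal U"
    and "\<And>f. order_function f \<Longrightarrow> \<exists>e B \<theta> n0. computes e B (char_fun A) \<and> partial_recursive \<theta> \<and>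
      (\<forall>n\<ge>n0. \<exists>i<2 ^ (n div 2). \<exists>d. \<theta> (pair n i) = Some d \<and>
        (\<forall>m<f n. \<forall>q\<in>queries e B m. smem d q \<longleftrightarrow> q \<in> B))"
  shows "anti_complex U A"
  unfolding anti_complex_def
proof (intro allI impI)
  fix f assume "order_function f"
  then have f: "recursive f" unfolding order_function_def by blast
  from assms(2)[OF \<open>order_function f\<close>] obtain e B \<theta> n0 where
    e: "computes e B (char_fun A)" and "partial_recursive \<theta>" and
    approx: "\<And>n. n \<ge> n0 \<Longrightarrow> \<exists>i<2 ^ (n div 2). \<exists>d. \<theta> (pair n i) = Some d \<and>
        (\<forall>m<f n. \<forall>q\<in>queries e B m. smem d q \<longleftrightarrow> q \<in> B)"
    by blast
  then obtain s where s: "stage_function s \<theta>" using partial_recursive_stage by blast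
  then have rs: "recursive2 s" unfolding stage_function_def by blast
  \<comment> \<open>\<open>I j\<close> is the value of the string \<open>j\<close> read in binary.
    Its last digit is the parity of \<open>n\<close>, the rest is \<open>i\<close>, and the length
    of the string is \<open>n div 2 + 1\<close>.\<close>
  define I where "I j = j + 1 - 2 ^ str_len j" for j
  define N where "N j = 2 * (str_len j - 1) + I j mod 2" for j
  define d where "d t j = s t (pair (N j) (I j div 2))" for t j
  \<comment> \<open>Wait for \<open>\<theta>\<close> to deliver a string and for \<open>e\<close> to
    halt with it on all arguments below \<open>f (N j)\<close>. An \<open>ev\<close> value of 2
    stands for output 1.\<close>
  define out where "out t j = (if d t j \<noteq> 0 \<and> (\<forall>m<f (N j). ev e (d t j - 1) t m \<noteq> 0)
    then Suc (code {m. ev e (d t j - 1) t m = 2} (f (N j))) else 0)" for t j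
  have I [rec_intros]: "recursive g \<Longrightarrow> recursive (\<lambda>x. I (g x))" for g
    unfolding I_def by (intro rec_intros)
  have N [rec_intros]: "recursive g \<Longrightarrow> recursive (\<lambda>x. N (g x))" for g
    unfolding N_def by (intro rec_intros)
  have d [rec_intros]: "recursive g \<Longrightarrow> recursive h \<Longrightarrow> recursive (\<lambda>x. d (g x) (h x))" for g h
    unfolding d_def by (intro rec_intros recursive2_comp[OF rs])
  have "recursive2 out"
    unfolding out_def
    by (intro rec_intros recursive_comp[OF f] recursive3_comp[OF recursive_ev[of e]])
  moreover have "y = y'" if out: "out t j = Suc y" "out t' j = Suc y'" for t t' j y y'
  proof -
    obtain u u' where "d t j = Suc u" "d t' j = Suc u'"
      using out by (cases "d t j"; cases "d t' j") (auto simp: out_def)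
    then have u: "d t j = Suc u" "d t' j = Suc u"
      using stage_function_unique[OF s] unfolding d_def by blast+
    have "ev e u t m = 2 \<longleftrightarrow> ev e u t' m = 2" if "m < f (N j)" for m
    proof -
      have "ev e u t m \<noteq> 0" "ev e u t' m \<noteq> 0"
        using \<open>out t j = Suc y\<close> \<open>out t' j = Suc y'\<close> u \<open>m < f (N j)\<close>
        by (auto simp: out_def split: if_splits)
      then obtain a b where "ev e u t m = Suc a" "ev e u t' m = Suc b"
        by (meson not0_implies_Suc)
      then show ?thesis using ev_unique[of e u t m a t' b] by simp
    qed
    then have "code {m. ev e u t m = 2} (f (N j)) = code {m. ev e u t' m = 2} (f (N j))"
      by (intro code_cong) auto
    then show ?thesis using that u by (auto simp: out_def split: if_splits)
  qed
  ultimately obtain \<psi> where \<psi>: "partial_recursive \<psi>" "\<And>x y. \<psi> x = Some y \<longleftrightarrow> (\<exists>t. out t x = Suc y)"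
    using partial_recursive_of_stages[of out] by blast
  obtain c where c: "\<And>j w. \<psi> j = Some w \<Longrightarrow> complexity U (str_of_nat w) \<le> enat (str_len j + c)"
    using optimal_number[OF assms(1) \<psi>(1)] by blast
  \<comment> \<open>From \<open>2 * c + 2\<close> on, the program length \<open>n div 2 + 1\<close>
    plus the constant \<open>c\<close> is at most \<open>n\<close>.\<close>
  have "complexity U (initial_segment A (f n)) \<le> enat n" if n: "n \<ge> max n0 (2 * c + 2)" for n
  proof -
    obtain i u where i: "i < 2 ^ (n div 2)" "\<theta> (pair n i) = Some u"
      and u: "\<And>m q. m < f n \<Longrightarrow> q \<in> queries e B m \<Longrightarrow> smem u q \<longleftrightarrow> q \<in> B"
      using approx[of n] n by auto
    let ?l = "Suc (n div 2)"
    let ?i = "2 * i + n mod 2"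
    define j where "j = 2 ^ ?l - 1 + ?i"
    have "?i < 2 ^ ?l" using i(1) by simp
    then have len: "str_len j = ?l" unfolding j_def by (intro str_len_unique) auto
    then have "I j = ?i" by (simp add: I_def) (simp add: j_def)
    then have IN: "I j div 2 = i" "N j = n" unfolding N_def len by auto
    obtain t1 where t1: "\<And>t. t \<ge> t1 \<Longrightarrow> s t (pair n i) = Suc u"
      using s i(2) unfolding stage_function_def by blast
    obtain t2 where t2: "\<And>t m. t \<ge> t2 \<Longrightarrow> m < f n \<Longrightarrow> ev e u t m = Suc (char_fun A m)"
      using eventually_all_less[of "f n" "\<lambda>m t. ev e u t m = Suc (char_fun A m)"]
        ev_oracle_agrees[OF e] u by metis
    let ?t = "max t1 t2"
    have "d ?t j = Suc u" unfolding d_def IN using t1[of ?t] by simp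
    then have "out ?t j = Suc (code {m. ev e u ?t m = 2} (f n))"
      using t2[of ?t] by (simp add: out_def IN del: One_nat_def)
    also have "code {m. ev e u ?t m = 2} (f n) = code A (f n)"
      using t2[of ?t] by (intro code_cong) (auto simp: char_fun_def)
    finally have "\<psi> j = Some (code A (f n))" using \<psi>(2) by blast
    from c[OF this] have "complexity U (initial_segment A (f n)) \<le> enat (?l + c)"
      unfolding initial_segment_eq len .
    also have "enat (?l + c) \<le> enat n" using n by (simp add: max_def split: if_splits)
    finally show ?thesis .
  qed
  then show "\<forall>\<^sub>F n in sequentially. complexity U (initial_segment A (f n)) \<le> enat n"
    unfolding eventually_sequentially by blast
qed

text \<open>
  Evaluation is strict, but \<^const>\<open>PRec\<close> acts as a lazy conditional: below \<open>x0\<close> the table is consulted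
  without any query.
\<close>

lemma graph_reduction:
  assumes B: "B = {pair n (c n) | n. True}" and "recursive N" "partial_recursive \<psi>"
    and F: "\<And>x. x0 \<le> x \<Longrightarrow> \<psi> (pair x (c (N x))) = Some (F x)"
  obtains e where "computes e B F" "\<And>x. x < x0 \<Longrightarrow> queries e B x = {}"
    "\<And>x. x0 \<le> x \<Longrightarrow> queries e B x \<subseteq> pair (N x) ` {..c (N x)}"
proof -
  obtain eN where eN: "\<And>B x. run B eN x (N x) {}"
    using recursive_query_free[OF assms(2)] by blast
  obtain e\<psi> where e\<psi>: "\<And>B x y. \<psi> x = Some y \<Longrightarrow> run B e\<psi> x y {}"
    using partial_recursive_query_free[OF assms(3)] by blast
  obtain et where et: "\<And>B x. run B et x (if x < x0 then F x else 0) {}"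
    using recursive_query_free[OF recursive_finite_table] by blast
  have "decidable (\<lambda>x. x0 \<le> x)" by (intro rec_intros)
  then obtain eb where eb: "\<And>B x. run B eb x (of_bool (x0 \<le> x)) {}"
    using recursive_query_free by blast
  have "decidable (\<lambda>x. x = 0)" by (intro rec_intros)
  then obtain en where en: "\<And>B x. run B en x (of_bool (x = 0)) {}"
    using recursive_query_free by blast
  \<comment> \<open>Asks for \<open>pair n 0\<close>, \<open>pair n 1\<close> and so on until the
    first positive answer, which is at \<open>c n\<close>. \<open>en\<close> negates the answers
    because \<open>PMin\<close> stops at 0.\<close>
  let ?s = "PMin (PComp en PQuery)"
  have mem: "pair n i \<in> B \<longleftrightarrow> i = c n" for n i unfolding B by auto
  have search: "run B ?s n (c n) (pair n ` {..c n})" for n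
  proof -
    have q: "run B (PComp en PQuery) (pair n i) (of_bool (i \<noteq> c n)) ({pair n i} \<union> {})" for i
      using run_comp[OF run_query en, of B "pair n i"] by (simp add: mem)
    have "run B ?s n (c n) (\<Union>i\<le>c n. {pair n i})"
    proof (rule run_min[where v="\<lambda>_. 0"])
      show "run B (PComp en PQuery) (pair n i) (Suc 0) {pair n i}" if "i < c n" for i
        using q[of i] that by simp
      show "run B (PComp en PQuery) (pair n (c n)) 0 {pair n (c n)}" using q[of "c n"] by simp
    qed
    then show ?thesis by (simp add: UNION_singleton_eq_range)
  qed
  let ?b = "PComp e\<psi> (PPair PFst (PComp ?s (PComp eN PFst)))"
  have body: "run B ?b (pair x z) (F x) (pair (N x) ` {..c (N x)})" if "x0 \<le> x" for x z
  proof -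
    have 1: "run B PFst (pair x z) x {}" using run_fst[of B "pair x z"] by simp
    show ?thesis
      using run_comp[OF run_pair[OF 1 run_comp[OF run_comp[OF 1 eN] search]] e\<psi>[OF F[OF that]]]
      by simp
  qed
  \<comment> \<open>The number of recursion steps is \<open>of_bool (x0 \<le> x)\<close>: with none
    only the table is read, with one the body runs and ignores the table value.\<close>
  let ?e = "PComp (PRec et ?b) (PPair (PPair PFst PSnd) eb)"
  have arg: "run B (PPair (PPair PFst PSnd) eb) x (pair x (of_bool (x0 \<le> x))) {}" for x
    using run_pair[OF run_pair[OF run_fst run_snd] eb, of B x] by simp
  have low: "run B ?e x (F x) {}" if "x < x0" for x
    using run_comp[OF arg[of x], of "PRec et ?b" "F x" "{}"] that run_rec_0[of B et x "F x" "{}"]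
      et[of B x] by simp
  have high: "run B ?e x (F x) (pair (N x) ` {..c (N x)})" if "x0 \<le> x" for x
  proof -
    have "run B (PRec et ?b) (pair x 0) 0 {}" using et[of B x] that by (intro run_rec_0) simp
    from run_rec_Suc[OF this body[OF that]]
    have "run B (PRec et ?b) (pair x 1) (F x) (pair (N x) ` {..c (N x)})" by simp
    then show ?thesis using run_comp[OF arg[of x]] that by simp
  qed
  show ?thesis
  proof (rule that[of ?e])
    show "computes ?e B F" unfolding computes_def using low high by (metis not_le)
  qed (use queries_eq[OF low] queries_eq[OF high] in auto)
qed

section \<open>Tiny use, traces and anti-complexity\<close>

lemma partial_recursive_total:
  assumes "recursive g" shows "partial_recursive (\<lambda>x. Some (g x))"
proof (rule partial_recursiveI)
  show "recursive2 (\<lambda>t x. Suc (g x))" by (intro rec_intros recursive_comp[OF assms])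
qed auto

lemma partial_recursive_comp:
  assumes "partial_recursive \<psi>" "recursive g" shows "partial_recursive (\<lambda>x. \<psi> (g x))"
proof -
  obtain s where s: "stage_function s \<psi>" using partial_recursive_stage[OF assms(1)] by blast
  then have rs: "recursive2 s" unfolding stage_function_def by blast
  have "recursive2 (\<lambda>t x. s t (g x))"
    by (intro recursive2_comp[OF rs] rec_intros recursive_comp[OF assms(2)])
  then show ?thesis
    by (rule partial_recursiveI) (use s in \<open>unfold stage_function_def, blast+\<close>)
qed

lemma stage_function_dom:
  assumes "stage_function s \<psi>" shows "z \<in> dom \<psi> \<longleftrightarrow> (\<exists>t. s t z \<noteq> 0)"
proof
  assume "z \<in> dom \<psi>"
  then obtain y t0 where "\<forall>t\<ge>t0. s t z = Suc y"
    using assms unfolding stage_function_def by blast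
  then show "\<exists>t. s t z \<noteq> 0" by (intro exI[of _ t0]) simp
next
  assume "\<exists>t. s t z \<noteq> 0"
  then obtain t y where "s t z = Suc y" using not0_implies_Suc by blast
  then show "z \<in> dom \<psi>" using assms unfolding stage_function_def by blast
qed

lemma uniform_graph_eq: "{pair n x | n x. x \<in> T n} = {z. rgt z \<in> T (lft z)}"
proof (intro set_eqI iffI; clarsimp)
  show "\<exists>n x. z = pair n x \<and> x \<in> T n" if "rgt z \<in> T (lft z)" for z
    using that by (intro exI[of _ "lft z"] exI[of _ "rgt z"]) simp
qed

lemma re_setI:
  assumes "decidable2 R" shows "re_set {z. \<exists>t. R t z}"
proof -
  let ?\<psi> = "\<lambda>z. if \<exists>t. R t z then Some 0 else None :: nat option"
  have "partial_recursive ?\<psi>"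
    by (rule partial_recursiveI[OF assms]) (auto simp: of_bool_def split: if_splits)
  moreover have "{z. \<exists>t. R t z} = dom ?\<psi>" by (auto split: if_splits)
  ultimately show ?thesis unfolding re_set_def by blast
qed

text \<open>\<open>\<theta> (pair n i)\<close> is the element of \<open>T n\<close> in position
  \<open>i\<close> in an enumeration without repetition, so an index below the cardinality names
  each element.\<close>

lemma uniformly_re_enumeration:
  assumes "uniformly_re T" "\<And>n. finite (T n)"
  obtains \<theta> where "partial_recursive \<theta>"
    "\<And>n x. x \<in> T n \<Longrightarrow> \<exists>i<card (T n). \<theta> (pair n i) = Some x"
proof -
  obtain \<psi> where \<psi>: "partial_recursive \<psi>" "{pair n x | n x. x \<in> T n} = dom \<psi>"
    using assms(1) unfolding uniformly_re_def re_set_def by blast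
  obtain s where s: "stage_function s \<psi>" using partial_recursive_stage[OF \<psi>(1)] by blast
  then have rs: "recursive2 s" unfolding stage_function_def by blast
  have dom: "x \<in> T n \<longleftrightarrow> (\<exists>t. s t (pair n x) \<noteq> 0)" for n x
  proof -
    have "x \<in> T n \<longleftrightarrow> pair n x \<in> dom \<psi>" unfolding \<psi>(2)[symmetric] by auto
    also have "\<dots> \<longleftrightarrow> (\<exists>t. s t (pair n x) \<noteq> 0)" by (rule stage_function_dom[OF s])
    finally show ?thesis .
  qed
  \<comment> \<open>\<open>q\<close> codes an element together with the first stage confirming it,
    so each element is listed once; \<open>pos\<close> counts the elements listed before
    \<open>q\<close>.\<close>
  define first where "first n q \<longleftrightarrow> s (rgt q) (pair n (lft q)) \<noteq> 0 \<and>
    (\<forall>t<rgt q. s t (pair n (lft q)) = 0)" for n q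
  define pos where "pos n q = (\<Sum>p<q. of_bool (first n p) :: nat)" for n q
  have "decidable2 first" unfolding first_def by (intro rec_intros recursive2_comp[OF rs])
  note [rec_intros] = recursive2_comp[of "\<lambda>n q. of_bool (first n q)", OF this]
  have "recursive2 pos" unfolding pos_def by (intro rec_intros)
  note [rec_intros] = recursive2_comp[OF this]
  define out where "out q z = (if first (lft z) q \<and> pos (lft z) q = rgt z then Suc (lft q) else 0)"
    for q z
  have "recursive2 out" unfolding out_def by (intro rec_intros)
  moreover have "y = y'" if "out q z = Suc y" "out q' z = Suc y'" for q q' z y y'
  proof -
    have less: "pos n q < pos n q'" if "first n q" "q < q'" for n q q'
    proof -
      have "pos n q < pos n (Suc q)" using that(1) by (simp add: pos_def)
      also have "\<dots> \<le> pos n q'" unfolding pos_def using that(2) by (intro sum_mono2) auto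
      finally show ?thesis .
    qed
    have "first (lft z) q" "first (lft z) q'" "pos (lft z) q = pos (lft z) q'"
      using that by (auto simp: out_def split: if_splits)
    then have "q = q'" using less[of "lft z" q q'] less[of "lft z" q' q] by force
    then show ?thesis using that by simp
  qed
  ultimately obtain \<theta> where \<theta>: "partial_recursive \<theta>"
    "\<And>z x. \<theta> z = Some x \<longleftrightarrow> (\<exists>q. out q z = Suc x)"
    using partial_recursive_of_stages[of out] by blast
  have "\<exists>i<card (T n). \<theta> (pair n i) = Some x" if x: "x \<in> T n" for n x
  proof -
    obtain t where "s t (pair n x) \<noteq> 0" "\<forall>t'<t. s t' (pair n x) = 0"
      using x exists_least_iff[of "\<lambda>t. s t (pair n x) \<noteq> 0"] unfolding dom by blast
    then have q: "first n (pair x t)" "lft (pair x t) = x" by (simp_all add: first_def)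
    define q where "q = pair x t"
    note q = q[folded q_def]
    \<comment> \<open>The listed codes up to \<open>q\<close> belong to distinct elements of
      \<open>T n\<close>, which puts the position of \<open>q\<close> below the cardinality.\<close>
    have "inj_on lft {p. p \<le> q \<and> first n p}"
    proof (rule inj_onI)
      fix p p' assume "p \<in> {p. p \<le> q \<and> first n p}" "p' \<in> {p. p \<le> q \<and> first n p}" "lft p = lft p'"
      then have "rgt p = rgt p'" unfolding first_def mem_Collect_eq by (metis linorder_neqE_nat)
      then show "p = p'" using \<open>lft p = lft p'\<close> by (metis pair_lft_rgt)
    qed
    moreover have "lft ` {p. p \<le> q \<and> first n p} \<subseteq> T n" unfolding first_def using dom by blast
    ultimately have "card {p. p \<le> q \<and> first n p} \<le> card (T n)"
      using card_inj_on_le assms(2) by blast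
    moreover have "card {p. p \<le> q \<and> first n p} = pos n (Suc q)"
    proof -
      have "{p. p \<le> q \<and> first n p} = {..<Suc q} \<inter> {p. first n p}" by auto
      then show ?thesis unfolding pos_def by (simp only: sum_of_bool_eq finite_lessThan) simp
    qed
    ultimately have "pos n q < card (T n)" using q(1) by (simp add: pos_def)
    moreover have "out q (pair n (pos n q)) = Suc x" using q by (simp add: out_def)
    ultimately show ?thesis using \<theta>(2) by blast
  qed
  with \<theta>(1) show ?thesis by (rule that)
qed

text \<open>Shows that the prefixes of \<open>A\<close> of recursively given length form a function
  weak truth-table reducible to \<open>A\<close>; such a function is traced later.\<close>

lemma code_program:
  assumes "recursive g" obtains e where "\<And>x. run A e x (code A (g x)) {..<g x}"
proof -
  have "recursive (\<lambda>z. 2 * lft z + 1 + rgt z)" by (intro rec_intros)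
  then obtain e1 where e1: "\<And>B z. run B e1 z (2 * lft z + 1 + rgt z) {}"
    using recursive_query_free by blast
  obtain eg where eg: "\<And>B z. run B eg z (g z) {}"
    using recursive_query_free[OF assms] by blast
  let ?s = "PComp e1 (PPair (PComp PSnd PSnd) (PComp PQuery (PComp PFst PSnd)))"
  let ?e = "PRec PZero ?s"
  have "run A ?s (pair x (pair n y)) (2 * y + 1 + of_bool (n \<in> A)) {n}" for x n y
  proof -
    let ?z = "pair x (pair n y)"
    have 1: "run A PSnd ?z (pair n y) {}" using run_snd[of A ?z] by simp
    have 2: "run A (PComp PSnd PSnd) ?z y {}"
      using run_comp[OF 1 run_snd] by simp
    have 3: "run A (PComp PQuery (PComp PFst PSnd)) ?z (of_bool (n \<in> A)) {n}"
      using run_comp[OF run_comp[OF 1 run_fst] run_query] by simp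
    show ?thesis using run_comp[OF run_pair[OF 2 3] e1] by simp
  qed
  note step = this
  have main: "run A ?e (pair x n) (code A n) {..<n}" for x n
  proof (induction n)
    case 0
    then show ?case using run_rec_0[OF run_zero] by fastforce
  next
    case (Suc n)
    show ?case using run_rec_Suc[OF Suc step] by (simp add: code_Suc lessThan_Suc)
  qed
  have "run A (PComp ?e (PPair PZero eg)) x (code A (g x)) {..<g x}" for x
    using run_comp[OF run_pair[OF run_zero eg] main] by simp
  then show ?thesis by (rule that)
qed

section \<open>Query bounds and weak truth-table reductions\<close>

lemma computes_PQuery: "computes PQuery A (char_fun A)"
  unfolding computes_def char_fun_def using run_query by blast

lemma queries_PQuery [simp]: "queries PQuery A m = {m}"
  by (rule queries_eq[OF run_query])

lemma use_fun_le_computes: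
  assumes "computes e B f"
  shows "use_fun e B n \<le> k \<longleftrightarrow> (\<forall>m<n. \<forall>q\<in>queries e B m. q < k)"
  using assms unfolding computes_def by (intro use_fun_le_iff) blast

text \<open>Replaces the cumulative use by a bound for each single computation; the computation at
  \<open>n\<close> is covered by the use at \<open>Suc n\<close>.\<close>

lemma fun_wtt_reducible_queries:
  assumes "fun_wtt_reducible f B"
  obtains e r where "computes e B f" "recursive r" "\<And>n q. q \<in> queries e B n \<Longrightarrow> q < r n"
proof -
  obtain e g where e: "computes e B f" "recursive g" "\<And>n. use_fun e B n \<le> g n"
    using assms unfolding fun_wtt_reducible_def by blast
  have "recursive (\<lambda>n. g (Suc n))" by (intro recursive_comp[OF e(2)] rec_intros)
  moreover have "q < g (Suc n)" if "q \<in> queries e B n" for n q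
    using e(3)[of "Suc n"] that unfolding use_fun_le_computes[OF e(1)] by blast
  ultimately show ?thesis using that e(1) by blast
qed

lemma fun_wtt_reducibleI:
  assumes "computes e B f" "recursive r" "\<And>n q. q \<in> queries e B n \<Longrightarrow> q < r n"
  shows "fun_wtt_reducible f B"
proof -
  have "recursive (\<lambda>n. \<Sum>m<n. r m)" by (intro rec_intros recursive_comp[OF assms(2)])
  moreover have "use_fun e B n \<le> (\<Sum>m<n. r m)" for n
    unfolding use_fun_le_computes[OF assms(1)]
    using assms(3) by (meson finite_lessThan lessThan_iff member_le_sum less_le_trans zero_le)
  ultimately show ?thesis unfolding fun_wtt_reducible_def using assms(1) by blast
qed

text \<open>Queries of the first reduction are answered by running the second. Only numbers below
  \<open>r n\<close> are asked for, so the sum of their bounds \<open>u\<close> bounds the new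
  queries.\<close>

lemma fun_wtt_reducible_trans:
  assumes "fun_wtt_reducible f X" "wtt_reducible X A"
  shows "fun_wtt_reducible f A"
proof -
  obtain e r where e: "computes e X f" "recursive r" "\<And>n q. q \<in> queries e X n \<Longrightarrow> q < r n"
    using fun_wtt_reducible_queries[OF assms(1)] by blast
  obtain d u where d: "computes d A (char_fun X)" "recursive u" "\<And>n q. q \<in> queries d A n \<Longrightarrow> q < u n"
    using fun_wtt_reducible_queries assms(2) unfolding wtt_reducible_def by blast
  have d_run: "run A d z (of_bool (z \<in> X)) (queries d A z)" for z
    using d(1) unfolding computes_def char_fun_def by (metis queries_eq)
  have run: "run A (qsubst d e) n (f n) (\<Union>z\<in>queries e X n. queries d A z)" for n
    using run_qsubst[OF _ d_run] e(1) unfolding computes_def by (metis queries_eq)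
  show ?thesis
  proof (rule fun_wtt_reducibleI)
    show "computes (qsubst d e) A f" unfolding computes_def using run by blast
    show "recursive (\<lambda>n. \<Sum>z<r n. u z)"
      by (intro rec_intros recursive_comp[OF d(2)] e(2))
    show "q < (\<Sum>z<r n. u z)" if q: "q \<in> queries (qsubst d e) A n" for n q
    proof -
      obtain z where z: "z < r n" "q < u z"
        using q e(3) d(3) unfolding queries_eq[OF run] by blast
      then have "u z \<le> (\<Sum>z<r n. u z)" by (intro member_le_sum) auto
      then show ?thesis using z(2) by simp
    qed
  qed
qed

lemma wtt_reducible_refl: "wtt_reducible A A"
  unfolding wtt_reducible_def
  by (rule fun_wtt_reducibleI[OF computes_PQuery, of Suc]) (auto intro: rec_intros)

text \<open>If the use is bounded by half the inverse of \<open>f\<close>, then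
  \<open>n div 2\<close> bits of \<open>B\<close> determine the first \<open>f n\<close> bits of
  \<open>A\<close>.\<close>

theorem tiny_use_imp_anti_complex:
  assumes "optimal U" "tiny_use_reducible A B" shows "anti_complex U A"
proof (rule anti_complexI[OF assms(1)])
  fix f assume f: "order_function f"
  then have "recursive f" "mono f" unfolding order_function_def by blast+
  define h where "h x = (LEAST n. x \<le> f n) div 2" for x
  have "recursive h"
    unfolding h_def by (intro rec_intros order_function_unbounded[OF f] recursive_comp[OF \<open>recursive f\<close>])
  moreover have "mono h"
  proof
    fix x y :: nat assume "x \<le> y"
    then have "x \<le> f (LEAST n. y \<le> f n)"
      using LeastI_ex[OF order_function_unbounded[OF f, of y]] by simp
    then show "h x \<le> h y" unfolding h_def by (intro div_le_mono Least_le)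
  qed
  moreover have "\<not> bdd_above (range h)"
  proof
    assume "bdd_above (range h)"
    then obtain k where k: "\<And>x. h x \<le> k" unfolding bdd_above_def by blast
    \<comment> \<open>By monotonicity the inverse of \<open>f\<close> at
      \<open>f (2 * Suc k) + 1\<close> exceeds \<open>2 * Suc k\<close>, so \<open>h\<close> there
      exceeds the assumed bound \<open>k\<close>.\<close>
    let ?n = "LEAST n. Suc (f (2 * Suc k)) \<le> f n"
    have "Suc (f (2 * Suc k)) \<le> f ?n" by (rule LeastI_ex[OF order_function_unbounded[OF f]])
    then have "2 * Suc k < ?n" using \<open>mono f\<close> by (meson Suc_n_not_le_n monoD not_less le_trans)
    then have "2 * Suc k div 2 \<le> h (Suc (f (2 * Suc k)))"
      unfolding h_def by (intro div_le_mono less_imp_le)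
    then have "Suc k \<le> h (Suc (f (2 * Suc k)))" by simp
    then show False using k by (meson Suc_n_not_le_n le_trans)
  qed
  ultimately have "order_function h" unfolding order_function_def by blast
  then obtain e where e: "computes e B (char_fun A)" "\<And>n. use_fun e B n \<le> h n"
    using assms(2) unfolding tiny_use_reducible_def by blast
  \<comment> \<open>Strings of length \<open>n div 2\<close> have consecutive numbers starting at
    \<open>2 ^ (n div 2) - 1\<close>, and \<open>i\<close> is the offset.\<close>
  let ?\<theta> = "\<lambda>z. Some (rgt z + 2 ^ (lft z div 2) - 1)"
  have "\<exists>i<2 ^ (n div 2). \<exists>d. ?\<theta> (pair n i) = Some d \<and>
      (\<forall>m<f n. \<forall>q\<in>queries e B m. smem d q \<longleftrightarrow> q \<in> B)" for n
  proof -
    let ?k = "n div 2"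
    have b: "2 ^ ?k \<le> code B ?k + 1" "code B ?k + 1 < 2 ^ Suc ?k"
      using str_len_bounds[of "code B ?k"] by simp_all
    have "h (f n) \<le> ?k" unfolding h_def by (intro div_le_mono Least_le) simp
    then have "q < ?k" if "m < f n" "q \<in> queries e B m" for m q
      using e(2)[of "f n"] that unfolding use_fun_le_computes[OF e(1)] by fastforce
    then have "\<forall>m<f n. \<forall>q\<in>queries e B m. smem (code B ?k) q \<longleftrightarrow> q \<in> B"
      by (auto simp: smem_code)
    then show ?thesis using b
      by (intro exI[of _ "code B ?k + 1 - 2 ^ ?k"] conjI exI[of _ "code B ?k"]) auto
  qed
  moreover have "partial_recursive ?\<theta>" by (intro partial_recursive_total rec_intros)
  ultimately show "\<exists>e B \<theta> n0. computes e B (char_fun A) \<and> partial_recursive \<theta> \<and>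
      (\<forall>n\<ge>n0. \<exists>i<2 ^ (n div 2). \<exists>d. \<theta> (pair n i) = Some d \<and>
        (\<forall>m<f n. \<forall>q\<in>queries e B m. smem d q \<longleftrightarrow> q \<in> B))"
    using e(1) by blast
qed

text \<open>A prefix of \<open>A\<close> is named by its index in a trace, at a cost depending on
  the fixed bound \<open>h\<close> only, while the length \<open>g\<close> of the prefix may grow as
  fast as desired.\<close>

theorem re_traceable_imp_anti_complex:
  assumes "optimal U" "re_traceable_degree (wtt_degree A)" shows "anti_complex U A"
proof (rule anti_complexI[OF assms(1)])
  fix f assume f: "order_function f"
  then have rf: "recursive f" and mf: "mono f" unfolding order_function_def by blast+
  obtain h where h: "order_function h" and trace: "\<And>F X. X \<in> wtt_degree A \<Longrightarrow> fun_wtt_reducible F X \<Longrightarrow>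
      \<exists>T. re_trace T F \<and> (\<forall>n. card (T n) \<le> h n)"
    using assms(2) unfolding re_traceable_degree_def by blast
  have rh: "recursive h" and mh: "mono h" using h unfolding order_function_def by blast+
  \<comment> \<open>Entry \<open>m\<close> will serve only those \<open>n\<close> with
    \<open>2 ^ (n div 2) < h (Suc m)\<close>, hence
    \<open>n \<le> 2 * h (Suc m) + 1\<close>.\<close>
  define g where "g m = f (2 * h (Suc m) + 1)" for m
  have "recursive g" unfolding g_def by (intro recursive_comp[OF rf] rec_intros recursive_comp[OF rh])
  then obtain e where e: "\<And>x. run A e x (code A (g x)) {..<g x}" using code_program by blast
  have "fun_wtt_reducible (\<lambda>m. code A (g m)) A"
  proof (rule fun_wtt_reducibleI)
    show "computes e A (\<lambda>m. code A (g m))" unfolding computes_def using e by blast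
    show "q < g n" if "q \<in> queries e A n" for n q using that unfolding queries_eq[OF e] by simp
  qed fact
  moreover have "A \<in> wtt_degree A" by (simp add: wtt_degree_def wtt_reducible_refl)
  ultimately obtain T where T: "uniformly_re T" "\<And>n. finite (T n)" "\<And>n. code A (g n) \<in> T n"
    "\<And>n. card (T n) \<le> h n"
    using trace unfolding re_trace_def by metis
  obtain \<theta> where \<theta>: "partial_recursive \<theta>"
    "\<And>n x. x \<in> T n \<Longrightarrow> \<exists>i<card (T n). \<theta> (pair n i) = Some x"
    using uniformly_re_enumeration[OF T(1,2)] by blast
  \<comment> \<open>For large \<open>n\<close> this is the last entry whose trace bound is at most
    \<open>2 ^ (n div 2)\<close>.\<close>
  define M where "M n = (LEAST m. 2 ^ (n div 2) < h (Suc m))" for n :: nat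
  have ex: "\<exists>m. y < h (Suc m)" for y
  proof -
    obtain x where "Suc y \<le> h x" using order_function_unbounded[OF h] by blast
    also have "h x \<le> h (Suc x)" using mh by (simp add: monoD)
    finally show ?thesis by (auto simp: Suc_le_eq)
  qed
  have rM: "recursive M" unfolding M_def by (intro rec_intros recursive_comp[OF rh] ex)
  let ?\<theta> = "\<lambda>z. \<theta> (pair (M (lft z)) (rgt z))"
  have "\<exists>i<2 ^ (n div 2). \<exists>d. ?\<theta> (pair n i) = Some d \<and>
      (\<forall>m<f n. \<forall>q\<in>queries PQuery A m. smem d q \<longleftrightarrow> q \<in> A)" if n: "n \<ge> 2 * h 1" for n
  proof -
    have up: "2 ^ (n div 2) < h (Suc (M n))" unfolding M_def by (rule LeastI_ex[OF ex])
    moreover have p: "n div 2 < 2 ^ (n div 2)" by (rule less_exp)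
    ultimately have "n \<le> 2 * h (Suc (M n)) + 1" by linarith
    then have "f n \<le> g (M n)" unfolding g_def using mf by (rule monoD[rotated])
    have "h 1 \<le> n div 2" using n by linarith
    \<comment> \<open>Minimality bounds \<open>h (M n)\<close> only if \<open>M n\<close> has a
      predecessor; the threshold \<open>2 * h 1\<close> ensures this.\<close>
    then have "M n \<noteq> 0" using up p by (metis One_nat_def less_trans not_less)
    then obtain k where k: "M n = Suc k" by (cases "M n") auto
    then have "k < (LEAST m. 2 ^ (n div 2) < h (Suc m))" unfolding M_def by simp
    then have "\<not> 2 ^ (n div 2) < h (Suc k)" by (rule not_less_Least)
    then have "card (T (M n)) \<le> 2 ^ (n div 2)" using T(4)[of "M n"] k by simp
    then obtain i where "i < 2 ^ (n div 2)" "\<theta> (pair (M n) i) = Some (code A (g (M n)))"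
      using \<theta>(2)[OF T(3)] by (meson less_le_trans)
    moreover have "\<forall>m<f n. \<forall>q\<in>queries PQuery A m. smem (code A (g (M n))) q \<longleftrightarrow> q \<in> A"
      using \<open>f n \<le> g (M n)\<close> by (simp add: smem_code)
    ultimately show ?thesis by auto
  qed
  moreover have "partial_recursive ?\<theta>"
    by (intro partial_recursive_comp[OF \<theta>(1)] rec_intros recursive_comp[OF rM])
  ultimately show "\<exists>e B \<theta> n0. computes e B (char_fun A) \<and> partial_recursive \<theta> \<and>
      (\<forall>n\<ge>n0. \<exists>i<2 ^ (n div 2). \<exists>d. \<theta> (pair n i) = Some d \<and>
        (\<forall>m<f n. \<forall>q\<in>queries e B m. smem d q \<longleftrightarrow> q \<in> B))"
    using computes_PQuery by blast
qed

text \<open>\<open>f n\<close> is computed from a prefix of \<open>A\<close> that has a program of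
  length at most \<open>n\<close>. Trying the outputs of all such programs as oracles yields at most
  one candidate value per program.\<close>

theorem anti_complex_imp_re_traceable:
  assumes "machine U" "anti_complex U A" shows "re_traceable_degree (wtt_degree A)"
proof -
  \<comment> \<open>Programs of length at most \<open>n\<close> have numbers below
    \<open>2 ^ Suc n\<close>; the extra 1 allows for \<open>f n\<close> itself, entered directly at
    the finitely many \<open>n < n0\<close>.\<close>
  let ?h = "\<lambda>n. 2 ^ Suc n + 1 :: nat"
  have "n \<le> ?h n" for n using less_exp[of "Suc n"] by linarith
  then have "\<not> bdd_above (range ?h)"
    unfolding bdd_above_def by (metis Suc_n_not_le_n le_trans rangeI)
  moreover have "mono ?h" by (intro monoI) (simp add: power_increasing)
  moreover have "recursive ?h" by (intro rec_intros)
  ultimately have "order_function ?h" unfolding order_function_def by blast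
  moreover have "\<exists>T. re_trace T f \<and> (\<forall>n. card (T n) \<le> ?h n)"
    if "X \<in> wtt_degree A" "fun_wtt_reducible f X" for f X
  proof -
    have "fun_wtt_reducible f A"
      using that fun_wtt_reducible_trans unfolding wtt_degree_def by blast
    then obtain e r where e: "computes e A f" "recursive r" "\<And>n q. q \<in> queries e A n \<Longrightarrow> q < r n"
      using fun_wtt_reducible_queries by blast
    obtain r' where r': "order_function r'" "\<And>n. r n \<le> r' n" using order_majorant[OF e(2)] by blast
    obtain n0 where n0: "\<And>n. n \<ge> n0 \<Longrightarrow> \<exists>j. j + 1 < 2 ^ Suc n \<and> on_numbers U j = Some (code A (r' n))"
      using anti_complexD[OF assms(2) r'(1)] by blast
    obtain s where s: "stage_function s (on_numbers U)"
      using assms(1) partial_recursive_stage unfolding machine_iff by blast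
    then have rs: "recursive2 s" unfolding stage_function_def by blast
    define R where "R t n y j \<longleftrightarrow> s t j \<noteq> 0 \<and> ev e (s t j - 1) t n = Suc y" for t n y j
    \<comment> \<open>The conditional has the form of \<open>recursive_finite_table\<close>, so
      membership at a stage is decidable although \<open>f\<close> is not assumed recursive.\<close>
    define T where "T n = {y. \<exists>t. (\<exists>j<2 ^ Suc n. R t n y j) \<or> (n < n0 \<and> y = (if n < n0 then f n else 0))}"
      for n
    have "decidable2 (\<lambda>t z. (\<exists>j<2 ^ Suc (lft z). R t (lft z) (rgt z) j) \<or>
        (lft z < n0 \<and> rgt z = (if lft z < n0 then f (lft z) else 0)))"
      unfolding R_def
      by (intro rec_intros recursive2_comp[OF rs] recursive3_comp[OF recursive_ev]
          recursive_comp[OF recursive_finite_table])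
    then have "uniformly_re T"
      unfolding uniformly_re_def uniform_graph_eq unfolding T_def mem_Collect_eq by (rule re_setI)
    have sub: "T n \<subseteq> (\<Union>j<2 ^ Suc n. {y. \<exists>t. R t n y j}) \<union> {f n}" for n unfolding T_def by auto
    have one: "finite {y. \<exists>t. R t n y j} \<and> card {y. \<exists>t. R t n y j} \<le> 1" for n j
    proof -
      have "y = y'" if "R t n y j" "R t' n y' j" for t t' y y'
      proof -
        have "s t j = Suc (s t j - 1)" "s t' j = Suc (s t' j - 1)" using that unfolding R_def by auto
        then have "s t j - 1 = s t' j - 1" using stage_function_unique[OF s] by blast
        then show ?thesis using that ev_unique unfolding R_def by metis
      qed
      then obtain y0 where "{y. \<exists>t. R t n y j} \<subseteq> {y0}" by blast
      then show ?thesis using card_mono[of "{y0}"] finite_subset[of _ "{y0}"] by auto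
    qed
    let ?V = "\<lambda>n. (\<Union>j<2 ^ Suc n. {y. \<exists>t. R t n y j}) \<union> {f n}"
    have fin: "finite (?V n)" for n using one by auto
    have "card (T n) \<le> ?h n" for n
    proof -
      have "card (T n) \<le> card (?V n)" using sub fin by (rule card_mono[rotated])
      also have "\<dots> \<le> card (\<Union>j<2 ^ Suc n. {y. \<exists>t. R t n y j}) + card {f n}" by (rule card_Un_le)
      also have "card (\<Union>j<2 ^ Suc n. {y. \<exists>t. R t n y j}) \<le> (\<Sum>j<2 ^ Suc n. card {y. \<exists>t. R t n y j})"
        by (rule card_UN_le) simp
      also have "\<dots> \<le> (\<Sum>j<(2::nat) ^ Suc n. 1)" using one by (intro sum_mono) blast
      finally show ?thesis by simp
    qed
    moreover have "f n \<in> T n" for n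
    proof (cases "n < n0")
      case False
      then obtain j where j: "j + 1 < 2 ^ Suc n" "on_numbers U j = Some (code A (r' n))"
        using n0[of n] by auto
      obtain t1 where t1: "\<And>t. t \<ge> t1 \<Longrightarrow> s t j = Suc (code A (r' n))"
        using s j(2) unfolding stage_function_def by blast
      have "smem (code A (r' n)) q \<longleftrightarrow> q \<in> A" if "q \<in> queries e A n" for q
        using e(3)[OF that] r'(2)[of n] by (simp add: smem_code)
      then obtain t2 where t2: "\<And>t. t \<ge> t2 \<Longrightarrow> ev e (code A (r' n)) t n = Suc (f n)"
        using ev_oracle_agrees[OF e(1)] by metis
      have "R (max t1 t2) n (f n) j" unfolding R_def using t1[of "max t1 t2"] t2[of "max t1 t2"] by simp
      then show ?thesis unfolding T_def using j(1) add_lessD1 by blast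
    qed (simp add: T_def)
    moreover have "finite (T n)" for n using sub fin finite_subset by blast
    ultimately show ?thesis unfolding re_trace_def using \<open>uniformly_re T\<close> by blast
  qed
  ultimately show ?thesis unfolding re_traceable_degree_def by blast
qed

section \<open>Short codes for long initial segments\<close>

lemma pair_mono: "a \<le> a' \<Longrightarrow> b \<le> b' \<Longrightarrow> pair a b \<le> pair a' b'"
proof -
  assume *: "a \<le> a'" "b \<le> b'"
  then have "triangle (a + b) \<le> triangle (a' + b')"
    unfolding triangle_def by (intro div_le_mono mult_le_mono) auto
  then show ?thesis using * by (simp add: prod_encode_def)
qed

lemma partial_recursive_map:
  assumes "partial_recursive \<psi>" "recursive2 g" "recursive a"
  shows "partial_recursive (\<lambda>z. map_option (g z) (\<psi> (a z)))"
proof -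
  obtain s where s: "stage_function s \<psi>" using partial_recursive_stage[OF assms(1)] by blast
  then have rs: "recursive2 s" unfolding stage_function_def by blast
  let ?s = "\<lambda>t z. if s t (a z) = 0 then 0 else Suc (g z (s t (a z) - 1))"
  have "recursive2 ?s"
    by (intro rec_intros recursive2_comp[OF rs] recursive2_comp[OF assms(2)] recursive_comp[OF assms(3)])
  then show ?thesis
  proof (rule partial_recursiveI)
    fix t z y assume *: "?s t z = Suc y"
    then obtain v where v: "s t (a z) = Suc v" by (cases "s t (a z)") auto
    then have "\<psi> (a z) = Some v" using s unfolding stage_function_def by blast
    then show "map_option (g z) (\<psi> (a z)) = Some y" using * v by simp
  next
    fix z y assume "map_option (g z) (\<psi> (a z)) = Some y"
    then obtain v where v: "\<psi> (a z) = Some v" "y = g z v" by auto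
    then obtain t where "s t (a z) = Suc v" using s unfolding stage_function_def by blast
    then show "\<exists>t. ?s t z = Suc y" using v(2) by (intro exI[of _ t]) simp
  qed
qed

text \<open>The empty set is computed without queries, so any string will do as the oracle
  prefix.\<close>

lemma anti_complex_empty:
  assumes "optimal U" shows "anti_complex U {}"
proof (rule anti_complexI[OF assms])
  fix f
  have run: "run {} PZero x 0 {}" for x by (rule run_zero)
  then have "computes PZero {} (char_fun {})" unfolding computes_def char_fun_def by auto
  moreover have "queries PZero {} m = {}" for m by (rule queries_eq[OF run])
  moreover have "partial_recursive (\<lambda>z. Some 0)"
    by (intro partial_recursive_total rec_intros)
  ultimately show "\<exists>e B \<theta> n0. computes e B (char_fun {}) \<and> partial_recursive \<theta> \<and>
      (\<forall>n\<ge>n0. \<exists>i<2 ^ (n div 2). \<exists>d. \<theta> (pair n i) = Some d \<and>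
        (\<forall>m<f n. \<forall>q\<in>queries e B m. smem d q \<longleftrightarrow> q \<in> B))"
    by (intro exI[of _ PZero] exI[of _ "{}"] exI[of _ "\<lambda>z. Some 0"] exI[of _ 0])
      (auto intro: exI[of _ 0])
qed

text \<open>
  The code \<open>0\<close> stands for \<open>p k = 0\<close>; any other code is the successor of a pair consisting of a program
  with halting time \<open>p k\<close> and of a program for an initial segment of \<open>A\<close>. For domination, recall that the
  empty set is anti-complex: the values of an order \<open>g\<close> have short programs, and the least halting
  time \<open>\<tau> k\<close> of a short program for \<open>g k\<close> is recursive in \<open>k\<close>, so that anti-complexity of \<open>A\<close> applies
  to a bound of \<open>\<tau>\<close>.
\<close>

lemma anti_complex_codes:
  assumes "optimal U" "anti_complex U A"
  obtains c b p conv \<psi> where "recursive b" "mono b" "\<And>k. c k < b k"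
    "decidable2 conv" "\<And>k x. conv x (c k) \<longleftrightarrow> p k \<le> x"
    "\<And>f. recursive f \<Longrightarrow> \<exists>k0. \<forall>k\<ge>k0. f k \<le> p k"
    "partial_recursive \<psi>" "\<And>k. \<exists>n\<ge>p k. \<psi> (c k) = Some (code A n)"
proof -
  have pU: "partial_recursive (on_numbers U)"
    using assms(1) unfolding optimal_def machine_iff by blast
  then obtain s where s: "stage_function s (on_numbers U)" using partial_recursive_stage by blast
  then have rs: "recursive2 s" unfolding stage_function_def by blast
  define first where "first r q \<longleftrightarrow> s q r \<noteq> 0 \<and> (\<forall>t<q. s t r = 0)" for r q
  have first_unique: "q = q'" if "first r q" "first r q'" for r q q'
    using that unfolding first_def by (metis linorder_neqE_nat)
  \<comment> \<open>\<open>r\<close> is a program with halting time \<open>q\<close>, and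
    \<open>w\<close> is a program for at least \<open>q\<close> bits of \<open>A\<close>. Each
    \<open>r\<close> has at most one halting time, so only finitely many \<open>q\<close>
    qualify.\<close>
  define good where "good k q \<longleftrightarrow> (\<exists>n r w. r < 2 ^ Suc k \<and> w < 2 ^ Suc k \<and> first r q \<and>
    q \<le> n \<and> on_numbers U w = Some (code A n))" for k q
  have fin: "finite {q. good k q}" for k
  proof (rule finite_subset)
    show "{q. good k q} \<subseteq> (\<Union>r\<in>{..<2 ^ Suc k}. {q. first r q})" unfolding good_def by auto
    have "finite {q. first r q}" for r
    proof -
      obtain q0 where "{q. first r q} \<subseteq> {q0}" using first_unique by blast
      then show ?thesis by (rule finite_subset) simp
    qed
    then show "finite (\<Union>r\<in>{..<2 ^ Suc k}. {q. first r q})" by blast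
  qed
  define p where "p k = (if \<exists>q. good k q then Max {q. good k q} else 0)" for k
  have p_good: "good k (p k)" if "\<exists>q. good k q" for k
    using Max_in[OF fin[of k]] that unfolding p_def by auto
  have p_ge: "q \<le> p k" if "good k q" for k q
    using Max_ge[OF fin[of k], of q] that unfolding p_def by auto
  define b where "b k = Suc (Suc (pair (2 ^ Suc k) (2 ^ Suc k)))" for k
  \<comment> \<open>For a nonzero code this asks whether the program \<open>r\<close> in it has
    halted by stage \<open>x\<close>, which decides \<open>p k \<le> x\<close> without computing
    \<open>p k\<close>.\<close>
  define conv where "conv x c \<longleftrightarrow> c = 0 \<or> (\<exists>t<Suc x. s t (lft (c - 1)) \<noteq> 0)" for x c
  let ?\<psi> = "\<lambda>c. if c = 0 then Some 0 else on_numbers U (rgt (c - 1))"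
  have "\<exists>c. c < b k \<and> (\<forall>x. conv x c \<longleftrightarrow> p k \<le> x) \<and> (\<exists>n\<ge>p k. ?\<psi> c = Some (code A n))" for k
  proof (cases "\<exists>q. good k q")
    case True
    then obtain n r w where *: "r < 2 ^ Suc k" "w < 2 ^ Suc k" "first r (p k)"
      "p k \<le> n" "on_numbers U w = Some (code A n)"
      using p_good unfolding good_def by blast
    have "conv x (Suc (pair r w)) \<longleftrightarrow> p k \<le> x" for x
    proof
      assume "conv x (Suc (pair r w))"
      then obtain t where "t \<le> x" "s t r \<noteq> 0" unfolding conv_def by (auto simp: less_Suc_eq_le)
      then show "p k \<le> x" using *(3) unfolding first_def by (meson le_trans not_less)
    next
      assume "p k \<le> x"
      then show "conv x (Suc (pair r w))" using *(3) unfolding conv_def first_def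
        by (auto intro!: exI[of _ "p k"])
    qed
    moreover have "Suc (pair r w) < b k"
      unfolding b_def using pair_mono[of r "2 ^ Suc k" w "2 ^ Suc k"] * by simp
    ultimately show ?thesis using * by (intro exI[of _ "Suc (pair r w)"]) auto
  next
    case False
    then have "p k = 0" by (simp add: p_def)
    then show ?thesis by (intro exI[of _ 0]) (auto simp: b_def conv_def intro: exI[of _ 0])
  qed
  then obtain c where c: "\<And>k. c k < b k" "\<And>k x. conv x (c k) \<longleftrightarrow> p k \<le> x"
    "\<And>k. \<exists>n\<ge>p k. ?\<psi> (c k) = Some (code A n)"
    by metis
  have dom: "\<exists>k0. \<forall>k\<ge>k0. f k \<le> p k" if f: "recursive f" for f
  proof -
    obtain g where g: "order_function g" "\<And>k. f k \<le> g k" using order_majorant[OF f] by blast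
    then have rg: "recursive g" unfolding order_function_def by blast
    obtain k0 where k0: "\<And>k. k \<ge> k0 \<Longrightarrow>
        \<exists>j. j + 1 < 2 ^ Suc k \<and> on_numbers U j = Some (code {} (g k))"
      using anti_complexD[OF anti_complex_empty[OF assms(1)] g(1)] by blast
    \<comment> \<open>\<open>2 ^ g k - 1\<close> is the number of the string of \<open>g k\<close>
      zeros. The disjunct \<open>k < k0\<close> keeps the search for \<open>t\<close> total.\<close>
    define P where "P k t \<longleftrightarrow> k < k0 \<or> (\<exists>r<2 ^ Suc k. s t r = Suc (2 ^ g k - 1) \<and> (\<forall>t'<t. s t' r = 0))"
      for k t
    have ex: "\<exists>t. P k t" for k
    proof (cases "k < k0")
      case False
      then obtain r where r: "r < 2 ^ Suc k" "on_numbers U r = Some (2 ^ g k - 1)"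
        using k0[of k] unfolding code_empty by (metis add_lessD1 not_less)
      then obtain t where "s t r = Suc (2 ^ g k - 1)" using s unfolding stage_function_def by blast
      then obtain t where t: "s t r \<noteq> 0" "\<forall>t'<t. s t' r = 0"
        using exists_least_iff[of "\<lambda>t. s t r \<noteq> 0"] by (metis Suc_neq_Zero)
      then have "s t r = Suc (s t r - 1)" by simp
      then have "on_numbers U r = Some (s t r - 1)" using s unfolding stage_function_def by blast
      then have "s t r = Suc (2 ^ g k - 1)" using r(2) t(1) by simp
      then show ?thesis using t(2) r(1) unfolding P_def by blast
    qed (simp add: P_def)
    define \<tau> where "\<tau> k = (LEAST t. P k t)" for k
    have P: "P k (\<tau> k)" for k unfolding \<tau>_def by (rule LeastI_ex[OF ex])
    have "decidable2 P" unfolding P_def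
      by (intro rec_intros recursive2_comp[OF rs] recursive_comp[OF rg])
    then have "recursive \<tau>" unfolding \<tau>_def by (intro recursive_Least ex)
    then obtain g' where g': "order_function g'" "\<And>k. \<tau> k \<le> g' k" using order_majorant by blast
    obtain k1 where k1: "\<And>k. k \<ge> k1 \<Longrightarrow>
        \<exists>j. j + 1 < 2 ^ Suc k \<and> on_numbers U j = Some (code A (g' k))"
      using anti_complexD[OF assms(2) g'(1)] by blast
    have "f k \<le> p k" if k: "k \<ge> max k0 k1" for k
    proof -
      obtain r where r: "r < 2 ^ Suc k" "s (\<tau> k) r = Suc (2 ^ g k - 1)" "\<forall>t'<\<tau> k. s t' r = 0"
        using P[of k] k unfolding P_def by auto
      \<comment> \<open>A stage bounds the output it shows, so the halting time lies above
        \<open>f k\<close>.\<close>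
      then have "2 ^ g k - 1 \<le> \<tau> k" using s unfolding stage_function_def by blast
      moreover have "g k < 2 ^ g k" by (rule less_exp)
      ultimately have "f k \<le> \<tau> k" using g(2)[of k] by linarith
      obtain w where w: "w + 1 < 2 ^ Suc k" "on_numbers U w = Some (code A (g' k))"
        using k1[of k] k by auto
      have "first r (\<tau> k)" unfolding first_def using r by simp
      then have "good k (\<tau> k)" unfolding good_def using r(1) w g'(2)[of k] add_lessD1 by blast
      then show ?thesis using p_ge \<open>f k \<le> \<tau> k\<close> le_trans by blast
    qed
    then show ?thesis by blast
  qed
  have "recursive b" unfolding b_def by (intro rec_intros)
  have "mono b" unfolding b_def
    by (intro monoI) (simp add: pair_mono power_increasing)
  have conv: "decidable2 conv" unfolding conv_def
    by (intro rec_intros recursive2_comp[OF rs] recursive_pred)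
  have "partial_recursive ?\<psi>"
  proof (rule partial_recursiveI)
    show "recursive2 (\<lambda>t c. if c = 0 then 1 else s t (rgt (c - 1)))"
      by (intro rec_intros recursive2_comp[OF rs] recursive_pred)
  next
    fix c y assume "?\<psi> c = Some y"
    then show "\<exists>t. (if c = 0 then 1 else s t (rgt (c - 1))) = Suc y"
      using s unfolding stage_function_def by (cases "c = 0") (simp, meson le_refl)
  qed (use s in \<open>auto simp: stage_function_def split: if_splits\<close>)
  from that[of b c conv p ?\<psi>, OF \<open>recursive b\<close> \<open>mono b\<close> c(1) conv c(2) dom this c(3)]
  show ?thesis .
qed

text \<open>One oracle, the graph of \<open>c\<close>, serves all orders \<open>h\<close>: the bit
  at \<open>x\<close> is read from the entry with the largest index that \<open>h x\<close> permits,
  and domination makes that entry long enough for almost all \<open>x\<close>.\<close>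

theorem anti_complex_imp_tiny_use:
  assumes "optimal U" "anti_complex U A" shows "\<exists>B. tiny_use_reducible A B"
proof -
  obtain c b p conv \<psi> where b: "recursive b" "mono b" and c: "\<And>k. c k < b k"
    and "decidable2 conv" "\<And>k x. conv x (c k) \<longleftrightarrow> p k \<le> x"
    and dom: "\<And>f. recursive f \<Longrightarrow> \<exists>k0. \<forall>k\<ge>k0. f k \<le> p k"
    and \<psi>: "partial_recursive \<psi>" "\<And>k. \<exists>n\<ge>p k. \<psi> (c k) = Some (code A n)"
    by (rule anti_complex_codes[OF assms]) (rule that; assumption)
  let ?B = "{pair n (c n) | n. True}"
  let ?\<psi> = "\<lambda>z. map_option (\<lambda>w. of_bool (smem w (lft z))) (\<psi> (rgt z))"
  have p\<psi>: "partial_recursive ?\<psi>"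
    by (intro partial_recursive_map[OF \<psi>(1)] rec_intros)
  have "\<exists>e. computes e ?B (char_fun A) \<and> (\<forall>n. use_fun e ?B n \<le> h n)" if h: "order_function h" for h
  proof -
    have rh: "recursive h" and mh: "mono h" using h unfolding order_function_def by blast+
    \<comment> \<open>A strict bound on the queries made while searching for
      \<open>c n\<close>.\<close>
    define Q where "Q n = Suc (pair n (b n))" for n
    have rQ: "recursive Q" unfolding Q_def by (intro rec_intros b(1))
    have mQ: "Q m \<le> Q n" if "m \<le> n" for m n
      unfolding Q_def using that b(2) by (simp add: pair_mono monoD)
    have Q_gt: "n < Q n" for n unfolding Q_def using le_prod_encode_1 by (simp add: less_Suc_eq_le)
    define N where "N x = (LEAST n. h x < Q (Suc n))" for x
    have ex: "\<exists>n. h x < Q (Suc n)" for x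
      using Q_gt[of "Suc (h x)"] by (intro exI[of _ "h x"]) simp
    have rN: "recursive N" unfolding N_def
      by (intro rec_intros ex recursive_comp[OF rQ] recursive_comp[OF rh])
    \<comment> \<open>An argument \<open>x\<close> with \<open>N x = n\<close> lies below
      \<open>f n\<close>, so \<open>f n \<le> p n\<close> guarantees that entry \<open>n\<close>
      covers it.\<close>
    define f where "f n = (LEAST x. Q (Suc n) \<le> h x)" for n
    have "recursive f" unfolding f_def
      by (intro rec_intros order_function_unbounded[OF h] recursive_comp[OF rQ] recursive_comp[OF rh])
    then obtain n0 where n0: "\<And>n. n \<ge> n0 \<Longrightarrow> f n \<le> p n" using dom by blast
    \<comment> \<open>Beyond \<open>x0\<close> the index \<open>N x\<close> exceeds
      \<open>n0\<close>, where domination holds. Arguments below \<open>x0\<close> are left to the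
      table.\<close>
    obtain x0 where x0: "Q (Suc n0) \<le> h x0" using order_function_unbounded[OF h] by blast
    have high: "n0 < N x \<and> x < p (N x) \<and> Q (N x) \<le> h x" if "x0 \<le> x" for x
    proof -
      have "Q (Suc n0) \<le> h x" using x0 that mh by (meson le_trans monoD)
      then have "\<not> h x < Q (Suc m)" if "m \<le> n0" for m
        using mQ[of "Suc m" "Suc n0"] that by simp
      moreover have less: "h x < Q (Suc (N x))" unfolding N_def by (rule LeastI_ex[OF ex])
      ultimately have "n0 < N x" using not_less by blast
      have "\<not> f (N x) \<le> x"
      proof
        assume "f (N x) \<le> x"
        then have "h (f (N x)) \<le> h x" using mh by (simp add: monoD)
        moreover have "Q (Suc (N x)) \<le> h (f (N x))"
          unfolding f_def by (rule LeastI_ex[OF order_function_unbounded[OF h]])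
        ultimately show False using less by simp
      qed
      then have "x < p (N x)" using n0[of "N x"] \<open>n0 < N x\<close> by simp
      obtain k where k: "N x = Suc k" using \<open>n0 < N x\<close> by (cases "N x") auto
      then have "k < (LEAST n. h x < Q (Suc n))" unfolding N_def by simp
      then have "\<not> h x < Q (Suc k)" by (rule not_less_Least)
      then show ?thesis using k \<open>n0 < N x\<close> \<open>x < p (N x)\<close> by simp
    qed
    have "?\<psi> (pair x (c (N x))) = Some (char_fun A x)" if "x0 \<le> x" for x
    proof -
      obtain n where "n \<ge> p (N x)" "\<psi> (c (N x)) = Some (code A n)" using \<psi>(2) by blast
      then show ?thesis using high[OF that] by (simp add: smem_code char_fun_def)
    qed
    from graph_reduction[OF refl rN p\<psi> this] obtain e where e: "computes e ?B (char_fun A)"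
      "\<And>x. x < x0 \<Longrightarrow> queries e ?B x = {}"
      "\<And>x. x0 \<le> x \<Longrightarrow> queries e ?B x \<subseteq> pair (N x) ` {..c (N x)}"
      by blast
    have "q < h n" if q: "x < n" "q \<in> queries e ?B x" for x n q
    proof -
      have "x0 \<le> x" using q(2) e(2) by (cases "x < x0") auto
      then obtain i where i: "q = pair (N x) i" "i \<le> c (N x)" using e(3) q(2) by blast
      then have "q < Q (N x)" unfolding Q_def using c[of "N x"] by (simp add: less_Suc_eq_le pair_mono)
      also have "\<dots> \<le> h x" using high[OF \<open>x0 \<le> x\<close>] by blast
      also have "\<dots> \<le> h n" using mh q(1) by (simp add: monoD)
      finally show ?thesis .
    qed
    then show ?thesis using e(1) use_fun_le_computes[OF e(1)] by blast
  qed
  then show ?thesis unfolding tiny_use_reducible_def by blast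
qed

section \<open>Prefix-free machines on numbers, and the descriptions provided by a Schnorr trivial
  oracle\<close>

lemma nat_of_str_append: "(nat_of_str (\<sigma> @ \<rho>) + 1) div 2 ^ length \<rho> = nat_of_str \<sigma> + 1"
proof (induction \<rho> rule: rev_induct)
  case (snoc b \<rho>)
  have "(nat_of_str (\<sigma> @ \<rho> @ [b]) + 1) div 2 = nat_of_str (\<sigma> @ \<rho>) + 1"
    using nat_of_str_snoc[of "\<sigma> @ \<rho>" b] by simp
  then show ?case using snoc by (simp add: div_mult2_eq)
qed simp

lemma prefix_number:
  assumes "prefix (str_of_nat i) (str_of_nat j)"
  shows "str_len i \<le> str_len j" "(j + 1) div 2 ^ (str_len j - str_len i) = i + 1"
proof -
  obtain \<rho> where \<rho>: "str_of_nat j = str_of_nat i @ \<rho>" using assms by (auto simp: prefix_def)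
  then have len: "str_len j = str_len i + length \<rho>" by (metis length_append length_str_of_nat)
  then show "str_len i \<le> str_len j" by simp
  show "(j + 1) div 2 ^ (str_len j - str_len i) = i + 1"
    using nat_of_str_append[of "str_of_nat i" \<rho>] \<rho> len by (metis add_diff_cancel_left' nat_of_str_of_nat)
qed

lemma on_strings_prefix_free:
  assumes "partial_recursive \<psi>"
    and "\<And>i j. i \<in> dom \<psi> \<Longrightarrow> j \<in> dom \<psi> \<Longrightarrow> prefix (str_of_nat i) (str_of_nat j) \<Longrightarrow> i = j"
  shows "prefix_free_machine (on_strings \<psi>)"
proof -
  have "\<sigma> = \<tau>" if "\<sigma> \<in> dom (on_strings \<psi>)" "\<tau> \<in> dom (on_strings \<psi>)" "prefix \<sigma> \<tau>" for \<sigma> \<tau>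
  proof -
    have "nat_of_str \<sigma> \<in> dom \<psi>" "nat_of_str \<tau> \<in> dom \<psi>"
      using that by (auto simp: on_strings_def)
    then have "nat_of_str \<sigma> = nat_of_str \<tau>" using assms(2) that(3) by simp
    then show ?thesis by (metis str_of_nat_of_str)
  qed
  then show ?thesis
    unfolding prefix_free_machine_def machine_iff on_numbers_on_strings using assms(1) by blast
qed

lemma dom_on_strings: "dom (on_strings \<psi>) = str_of_nat ` dom \<psi>"
proof (intro set_eqI iffI)
  fix \<sigma> assume "\<sigma> \<in> dom (on_strings \<psi>)"
  then have "nat_of_str \<sigma> \<in> dom \<psi>" by (auto simp: on_strings_def)
  then show "\<sigma> \<in> str_of_nat ` dom \<psi>" by (intro image_eqI[of _ _ "nat_of_str \<sigma>"]) simp_all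
qed (auto simp: on_strings_def)

lemma inj_str_of_nat: "inj str_of_nat"
  by (metis injI nat_of_str_of_nat)

text \<open>Schnorr triviality turns the short program for the number \<open>g k\<close> into a
  short program for the first \<open>g k\<close> bits of \<open>S\<close>, enough to answer the
  queries of the reduction.\<close>

theorem schnorr_trivial_imp_anti_complex:
  assumes "optimal U" "schnorr_trivial S" "wtt_reducible A S" shows "anti_complex U A"
proof (rule anti_complexI[OF assms(1)])
  fix f assume f: "order_function f"
  then have rf: "recursive f" and mf: "mono f" unfolding order_function_def by blast+
  obtain e r where e: "computes e S (char_fun A)" "recursive r" "\<And>n q. q \<in> queries e S n \<Longrightarrow> q < r n"
    using fun_wtt_reducible_queries assms(3) unfolding wtt_reducible_def by blast
  \<comment> \<open>Bounds every query for the first \<open>f (4 * k + 3)\<close> bits; with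
    \<open>k = n div 4\<close> this covers \<open>f n\<close>.\<close>
  define g where "g k = (\<Sum>m<f (4 * k + 3). r m)" for k
  have rg: "recursive g" unfolding g_def
    by (intro rec_intros recursive_comp[OF rf] recursive_comp[OF e(2)])
  define K where "K j = (LEAST k. j \<le> 2 ^ Suc k)" for j :: nat
  have ex: "\<exists>k. j \<le> 2 ^ Suc k" for j :: nat
    by (rule exI[of _ j]) (use less_exp[of "Suc j"] in linarith)
  have rK: "recursive K" unfolding K_def by (intro rec_intros ex)
  have K: "K (2 ^ Suc k) = k" for k unfolding K_def by (rule Least_equality) auto
  \<comment> \<open>\<open>2 ^ Suc k\<close> is the number of the string consisting of
    \<open>k\<close> zeros and a final 1; \<open>K\<close> recovers \<open>k\<close> from
    it.\<close>
  define \<mu> where "\<mu> j = (if j = 2 ^ Suc (K j) then Some (g (K j)) else None)" for j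
  have "partial_recursive \<mu>"
  proof (rule partial_recursiveI)
    show "recursive2 (\<lambda>t j. if j = 2 ^ Suc (K j) then Suc (g (K j)) else 0)"
      by (intro rec_intros recursive_comp[OF rK] recursive_comp[OF rg])
  qed (auto simp: \<mu>_def split: if_splits)
  have dom: "dom \<mu> = (\<lambda>k. 2 ^ Suc k) ` UNIV"
  proof (intro set_eqI iffI)
    show "j \<in> dom \<mu>" if "j \<in> (\<lambda>k. 2 ^ Suc k) ` UNIV" for j
      using that K by (auto simp: \<mu>_def dom_def)
  qed (auto simp: \<mu>_def dom_def split: if_splits)
  have len: "str_len (2 ^ Suc k) = Suc k" for k
    using one_less_power[of "2::nat" "Suc k"] by (intro str_len_unique) simp_all
  have "prefix_free_machine (on_strings \<mu>)"
  proof (rule on_strings_prefix_free)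
    fix i j assume "i \<in> dom \<mu>" "j \<in> dom \<mu>" and pre: "prefix (str_of_nat i) (str_of_nat j)"
    then obtain k l where kl: "i = 2 ^ Suc k" "j = 2 ^ Suc l" unfolding dom by auto
    from prefix_number[OF pre] have *: "k \<le> l" "(2 ^ Suc l + 1) div 2 ^ (l - k) = 2 ^ Suc k + (1::nat)"
      unfolding kl len by auto
    show "i = j"
    proof (rule ccontr)
      assume "i \<noteq> j"
      then obtain d where d: "l = k + Suc d" using *(1) kl less_imp_Suc_add
        by (metis add_Suc_right le_neq_implies_less)
      \<comment> \<open>A proper truncation loses the final 1, so it is not in the domain.\<close>
      have "(2 ^ Suc l + 1) div 2 ^ (l - k) = (1 + 2 ^ Suc k * 2 ^ Suc d) div (2 ^ Suc d :: nat)"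
        by (simp add: d power_add algebra_simps)
      also have "\<dots> = 2 ^ Suc k + 1 div 2 ^ Suc d" by (rule div_mult_self1) simp
      also have "1 div 2 ^ Suc d = (0::nat)"
        using one_less_power[of "2::nat" "Suc d"] by (intro div_less) simp
      finally show False using *(2) by simp
    qed
  qed fact
  moreover have "recursive_measure_domain (on_strings \<mu>)"
  proof -
    have "inj (\<lambda>k. str_of_nat (2 ^ Suc k))"
      by (rule injI) (metis K nat_of_str_of_nat)
    moreover have "((\<lambda>k. (1 / 2) ^ Suc k) has_sum (1::real)) UNIV"
      by (intro sums_nonneg_imp_has_sum power_half_series) simp
    ultimately have "((\<lambda>\<tau>. (1 / 2) ^ length \<tau>) has_sum (1::real)) ((\<lambda>k. str_of_nat (2 ^ Suc k)) ` UNIV)"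
      by (subst has_sum_reindex) (auto simp only: o_def length_str_of_nat len)
    then have "((\<lambda>\<tau>. (1 / 2) ^ length \<tau>) has_sum (1::real)) (dom (on_strings \<mu>))"
      unfolding dom_on_strings dom image_image .
    moreover have "recursive_real 1"
      unfolding recursive_real_def
      by (intro exI[of _ "\<lambda>_. 1"] exI[of _ "\<lambda>_. 0"] conjI rec_intros) auto
    ultimately show ?thesis unfolding recursive_measure_domain_def by blast
  qed
  ultimately obtain N c where N: "prefix_free_machine N"
    "\<And>n. complexity N (initial_segment S n) \<le> complexity (on_strings \<mu>) (str_of_nat n) + enat c"
    using assms(2) unfolding schnorr_trivial_def by blast
  let ?\<theta> = "\<lambda>z. on_numbers N (rgt z)"
  have "\<exists>i<2 ^ (n div 2). \<exists>d. ?\<theta> (pair n i) = Some d \<and>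
      (\<forall>m<f n. \<forall>q\<in>queries e S m. smem d q \<longleftrightarrow> q \<in> S)" if n: "n \<ge> 4 * c + 8" for n
  proof -
    let ?k = "n div 4"
    have \<mu>_k: "\<mu> (2 ^ Suc ?k) = Some (g ?k)" unfolding \<mu>_def K by simp
    have "complexity (on_strings \<mu>) (str_of_nat (g ?k)) \<le> enat (Suc ?k)"
      unfolding complexity_le_iff_number on_numbers_on_strings
      by (rule exI[of _ "2 ^ Suc ?k"], rule conjI[OF _ \<mu>_k]) (simp only: len order_refl)
    then have "complexity (on_strings \<mu>) (str_of_nat (g ?k)) + enat c \<le> enat (Suc ?k) + enat c"
      by (rule add_right_mono)
    then have "complexity N (str_of_nat (code S (g ?k))) \<le> enat (Suc ?k + c)"
      using N(2)[of "g ?k"] unfolding initial_segment_eq plus_enat_simps by (rule order_trans[rotated])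
    then obtain j where j: "str_len j \<le> Suc ?k + c" "on_numbers N j = Some (code S (g ?k))"
      unfolding complexity_le_iff_number by blast
    have "j < 2 ^ Suc (Suc ?k + c)" using j(1) unfolding str_len_le_iff by simp
    also have "\<dots> \<le> 2 ^ (n div 2)" using n by (intro power_increasing) auto
    finally have "j < 2 ^ (n div 2)" .
    moreover have "smem (code S (g ?k)) q \<longleftrightarrow> q \<in> S" if "m < f n" "q \<in> queries e S m" for m q
    proof -
      have "n \<le> 4 * ?k + 3" by simp
      then have "m < f (4 * ?k + 3)" using that(1) mf by (meson less_le_trans monoD)
      then have "r m \<le> g ?k" unfolding g_def by (intro member_le_sum) auto
      then show ?thesis using e(3)[OF that(2)] by (simp add: smem_code)
    qed
    ultimately show ?thesis using j(2) by (intro exI[of _ j]) auto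
  qed
  moreover have "partial_recursive (on_numbers N)"
    using N(1) unfolding prefix_free_machine_def machine_iff by blast
  note partial_recursive_comp[OF this recursive_rgt[OF recursive_id]]
  ultimately show "\<exists>e B \<theta> n0. computes e B (char_fun A) \<and> partial_recursive \<theta> \<and>
      (\<forall>n\<ge>n0. \<exists>i<2 ^ (n div 2). \<exists>d. \<theta> (pair n i) = Some d \<and>
        (\<forall>m<f n. \<forall>q\<in>queries e B m. smem d q \<longleftrightarrow> q \<in> B))"
    using e(1) by blast
qed

section \<open>Weights and prefix-free machines\<close>

text \<open>
  The partial sums of the weights are kept as dyadic rationals with denominator \<open>2 ^ den_exp L t\<close>.
\<close>

definition den_exp :: "(nat \<Rightarrow> nat) \<Rightarrow> nat \<Rightarrow> nat" where
  "den_exp L t = (\<Sum>q<t. L q)"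

definition num_sum :: "(nat \<Rightarrow> bool) \<Rightarrow> (nat \<Rightarrow> nat) \<Rightarrow> nat \<Rightarrow> nat" where
  "num_sum V L t = (\<Sum>q<t. of_bool (V q) * 2 ^ (den_exp L t - L q))"

definition weight :: "(nat \<Rightarrow> bool) \<Rightarrow> (nat \<Rightarrow> nat) \<Rightarrow> nat \<Rightarrow> real" where
  "weight V L q = (if V q then (1 / 2) ^ L q else 0)"

lemma weight_nonneg [simp]: "0 \<le> weight V L q"
  by (simp add: weight_def)

lemma sum_weight_eq: "(\<Sum>q<t. weight V L q) = real (num_sum V L t) / 2 ^ den_exp L t"
proof -
  have "weight V L q = of_bool (V q) * 2 ^ (den_exp L t - L q) / 2 ^ den_exp L t" if "q < t" for q
  proof -
    have "L q \<le> den_exp L t" unfolding den_exp_def using that by (intro member_le_sum) auto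
    then show ?thesis by (simp add: weight_def power_diff power_one_over field_simps)
  qed
  then have "(\<Sum>q<t. weight V L q) =
      (\<Sum>q<t. of_bool (V q) * 2 ^ (den_exp L t - L q) / 2 ^ den_exp L t)" by simp
  then show ?thesis
    by (simp only: num_sum_def sum_divide_distrib of_nat_sum of_nat_mult of_nat_of_bool
        of_nat_power of_nat_numeral)
qed

lemma recursive_den_exp:
  assumes "recursive L" shows "recursive (den_exp L)"
  unfolding den_exp_def by (intro rec_intros recursive_comp[OF assms])

lemma recursive_num_sum:
  assumes "decidable V" "recursive L" shows "recursive (num_sum V L)"
  unfolding num_sum_def
  by (intro rec_intros recursive_comp[OF assms(1)] recursive_comp[OF assms(2)]
      recursive_comp[OF recursive_den_exp[OF assms(2)]])

lemma sum_atLeastLessThan_eq_diff: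
  fixes f :: "nat \<Rightarrow> real" assumes "m \<le> n"
  shows "(\<Sum>q\<in>{m..<n}. f q) = (\<Sum>q<n. f q) - (\<Sum>q<m. f q)"
  using sum_diff_nat_ivl[of 0 m n f] assms by (simp add: atLeast0LessThan)

text \<open>If a series of nonnegative terms has a recursive sum, comparing partial sums with
  approximations to the sum yields a recursive modulus of convergence.\<close>

lemma recursive_tail:
  assumes V: "decidable V" and L: "recursive L" and sums: "weight V L sums \<alpha>"
    and "recursive_real \<alpha>"
  obtains v where "recursive v" "\<And>k J. (\<Sum>q\<in>{v k..<J}. weight V L q) \<le> (1 / 2) ^ k"
proof -
  obtain a b d where abd: "recursive a" "recursive b" "recursive d"
    "\<And>k. \<bar>\<alpha> - (real (a k) - real (b k)) / (real (d k) + 1)\<bar> \<le> (1 / 2) ^ k"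
    using assms(4) unfolding recursive_real_def by blast
  define x where "x k = (real (a k) - real (b k)) / (real (d k) + 1)" for k
  let ?E = "den_exp L" and ?N = "num_sum V L"
  \<comment> \<open>The comparison in \<open>P_iff\<close>, with denominators and subtractions
    cleared so that it is decided in the natural numbers.\<close>
  define P where "P k t \<longleftrightarrow> a (k + 2) * 2 ^ ?E t * 2 ^ (k + 2) <
    b (k + 2) * 2 ^ ?E t * 2 ^ (k + 2) + 2 * Suc (d (k + 2)) * 2 ^ ?E t +
    ?N t * Suc (d (k + 2)) * 2 ^ (k + 2)" for k t
  have P_iff: "P k t \<longleftrightarrow> x (k + 2) - 2 * (1 / 2) ^ (k + 2) < (\<Sum>q<t. weight V L q)" for k t
  proof -
    have *: "A * e * p < B * e * p + 2 * d' * e + n * d' * p \<longleftrightarrow> (A - B) / d' - 2 * (1 / p) < n / e"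
      if "0 < e" "0 < p" "0 < d'" for A B d' e p n :: real
      using that by (simp add: field_simps)
    have "P k t \<longleftrightarrow> real (a (k + 2) * 2 ^ ?E t * 2 ^ (k + 2)) <
        real (b (k + 2) * 2 ^ ?E t * 2 ^ (k + 2) + 2 * Suc (d (k + 2)) * 2 ^ ?E t +
        ?N t * Suc (d (k + 2)) * 2 ^ (k + 2))"
      unfolding P_def of_nat_less_iff ..
    also have "\<dots> \<longleftrightarrow> real (a (k + 2)) * 2 ^ ?E t * 2 ^ (k + 2) <
        real (b (k + 2)) * 2 ^ ?E t * 2 ^ (k + 2) + 2 * (real (d (k + 2)) + 1) * 2 ^ ?E t +
        real (?N t) * (real (d (k + 2)) + 1) * 2 ^ (k + 2)"
      by (simp only: of_nat_add of_nat_mult of_nat_power of_nat_numeral of_nat_Suc add.commute[of 1])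
    also have "\<dots> \<longleftrightarrow> x (k + 2) - 2 * (1 / 2 ^ (k + 2)) < real (?N t) / 2 ^ ?E t"
      unfolding x_def by (rule *) auto
    finally show ?thesis unfolding sum_weight_eq power_one_over .
  qed
  have ex: "\<exists>t. P k t" for k
  proof -
    have "x (k + 2) - (1 / 2) ^ (k + 2) \<le> \<alpha>" using abd(4)[of "k + 2"] unfolding x_def by linarith
    then have "x (k + 2) - 2 * (1 / 2) ^ (k + 2) < \<alpha>"
      using zero_less_power[of "1 / 2 :: real" "k + 2"] by linarith
    moreover have "(\<lambda>t. \<Sum>q<t. weight V L q) \<longlonglongrightarrow> \<alpha>" using sums by (simp add: sums_def)
    ultimately have "\<forall>\<^sub>F t in sequentially. x (k + 2) - 2 * (1 / 2) ^ (k + 2) < (\<Sum>q<t. weight V L q)"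
      by (intro order_tendstoD)
    then show ?thesis unfolding P_iff eventually_sequentially by blast
  qed
  define v where "v k = (LEAST t. P k t)" for k
  have v: "P k (v k)" for k unfolding v_def by (rule LeastI_ex[OF ex])
  have "decidable2 P" unfolding P_def
    by (intro rec_intros recursive_comp[OF abd(1)] recursive_comp[OF abd(2)] recursive_comp[OF abd(3)]
        recursive_comp[OF recursive_den_exp[OF L]] recursive_comp[OF recursive_num_sum[OF V L]])
  then have "recursive v" unfolding v_def by (intro recursive_Least ex)
  moreover have "(\<Sum>q\<in>{v k..<J}. weight V L q) \<le> (1 / 2) ^ k" for k J
  proof (cases "v k \<le> J")
    case True
    \<comment> \<open>The approximation error and the margin in \<open>P\<close> contribute at most
      \<open>3 * (1 / 2) ^ (k + 2)\<close>, which is below \<open>(1 / 2) ^ k\<close>.\<close>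
    have "(\<Sum>q<J. weight V L q) \<le> \<alpha>"
      using sum_le_suminf[of "weight V L" "{..<J}"] sums by (simp add: sums_iff)
    moreover have "\<alpha> \<le> x (k + 2) + (1 / 2) ^ (k + 2)" using abd(4)[of "k + 2"] unfolding x_def by linarith
    moreover have "x (k + 2) - 2 * (1 / 2) ^ (k + 2) < (\<Sum>q<v k. weight V L q)"
      using v unfolding P_iff .
    moreover have "4 * (1 / 2) ^ (k + 2) = ((1 / 2) ^ k :: real)" by simp
    moreover have "0 \<le> ((1 / 2) ^ k :: real)" by simp
    ultimately show ?thesis unfolding sum_atLeastLessThan_eq_diff[OF True] by linarith
  qed simp
  ultimately show ?thesis by (rule that)
qed

text \<open>The converse passage: partial sums up to a modulus are fast converging
  rationals.\<close>

lemma recursive_real_of_tail: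
  assumes V: "decidable V" and L: "recursive L" and sums: "weight V L sums \<beta>"
    and v: "recursive v" "\<And>k J. (\<Sum>q\<in>{v k..<J}. weight V L q) \<le> (1 / 2) ^ k"
  shows "recursive_real \<beta>"
  unfolding recursive_real_def
proof (intro exI conjI allI)
  let ?E = "den_exp L" and ?N = "num_sum V L"
  show "recursive (\<lambda>k. ?N (v k))" "recursive (\<lambda>k. 0)" "recursive (\<lambda>k. 2 ^ ?E (v k) - 1)"
    by (intro rec_intros v(1) recursive_comp[OF recursive_den_exp[OF L]]
        recursive_comp[OF recursive_num_sum[OF V L]])+
  show "\<bar>\<beta> - (real (?N (v k)) - real 0) / (real (2 ^ ?E (v k) - 1) + 1)\<bar> \<le> (1 / 2) ^ k" for k
  proof -
    have "(real (?N (v k)) - real 0) / (real (2 ^ ?E (v k) - 1) + 1) = (\<Sum>q<v k. weight V L q)"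
      unfolding sum_weight_eq by (simp add: of_nat_diff)
    moreover have "(\<Sum>q<v k. weight V L q) \<le> \<beta>"
      using sum_le_suminf[of "weight V L" "{..<v k}"] sums by (simp add: sums_iff)
    moreover have "\<beta> \<le> (\<Sum>q<v k. weight V L q) + (1 / 2) ^ k"
    proof (rule LIMSEQ_le_const2)
      show "(\<lambda>J. \<Sum>q<J. weight V L q) \<longlonglongrightarrow> \<beta>" using sums by (simp add: sums_def)
      have "(\<Sum>q<J. weight V L q) \<le> (\<Sum>q<v k. weight V L q) + (1 / 2) ^ k" if "J \<ge> v k" for J
        using v(2)[of k J] unfolding sum_atLeastLessThan_eq_diff[OF that] by linarith
      then show "\<exists>N. \<forall>J\<ge>N. (\<Sum>q<J. weight V L q) \<le> (\<Sum>q<v k. weight V L q) + (1 / 2) ^ k"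
        by blast
    qed
    ultimately show ?thesis by linarith
  qed
qed

lemma ceil_div:
  fixes x y :: nat assumes "0 < y"
  shows "x \<le> (x + y - 1) div y * y" "(x + y - 1) div y * y < x + y"
proof -
  have "(x + y - 1) div y * y + (x + y - 1) mod y = x + y - 1" by simp
  moreover have "(x + y - 1) mod y < y" using assms by simp
  ultimately show "x \<le> (x + y - 1) div y * y" "(x + y - 1) div y * y < x + y"
    using assms by linarith+
qed

text \<open>
  Shannon-Fano-Elias coding: request \<open>i\<close> receives the string of length \<open>Suc (L i)\<close> whose dyadic interval
  \<open>[lo i, hi i]\<close> starts at the first multiple of its length above the sum \<open>A i\<close> of the earlier weights
  and therefore lies within \<open>[A i, A (Suc i)]\<close>.
\<close>

lemma kraft_machine:
  assumes V: "decidable V" and L: "recursive L" and out: "recursive out"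
    and le_1: "\<And>J. (\<Sum>i<J. weight V L i) \<le> 1"
    and v: "recursive v" "\<And>k J. (\<Sum>i\<in>{v k..<J}. weight V L i) \<le> (1 / 2) ^ k"
  obtains N where "prefix_free_machine N" "recursive_measure_domain N"
    "\<And>i. V i \<Longrightarrow> complexity N (str_of_nat (out i)) \<le> enat (Suc (L i))"
proof -
  let ?E = "den_exp L" and ?N = "num_sum V L"
  define A where "A i = (\<Sum>j<i. weight V L j)" for i
  \<comment> \<open>\<open>A i\<close> times \<open>2 ^ Suc (L i)\<close>, rounded up.\<close>
  define Q where "Q i = (?N i * 2 ^ Suc (L i) + 2 ^ ?E i - 1) div 2 ^ ?E i" for i
  \<comment> \<open>The number of the string of length \<open>Suc (L i)\<close> whose binary value
    is \<open>Q i\<close>.\<close>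
  define J where "J i = 2 ^ Suc (L i) - 1 + Q i" for i
  define lo where "lo i = real (Q i) / 2 ^ Suc (L i)" for i
  define hi where "hi i = (real (Q i) + 1) / 2 ^ Suc (L i)" for i
  have rE: "recursive ?E" and rN: "recursive ?N"
    using recursive_den_exp[OF L] recursive_num_sum[OF V L] by blast+
  have rQ: "recursive Q" unfolding Q_def
    by (intro rec_intros recursive_comp[OF rE] recursive_comp[OF rN] recursive_comp[OF L])
  have rJ: "recursive J" unfolding J_def
    by (intro rec_intros recursive_comp[OF rQ] recursive_comp[OF L])
  have A_mono: "A i \<le> A j" if "i \<le> j" for i j
    unfolding A_def using that by (intro sum_mono2) auto
  have lo: "A i \<le> lo i" for i
  proof -
    have "?N i * 2 ^ Suc (L i) \<le> Q i * 2 ^ ?E i" unfolding Q_def by (rule ceil_div) simp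
    then have "real (?N i * 2 ^ Suc (L i)) \<le> real (Q i * 2 ^ ?E i)" by (simp only: of_nat_le_iff)
    then show ?thesis unfolding A_def lo_def sum_weight_eq by (simp add: field_simps)
  qed
  have lo_hi: "lo i < hi i" for i unfolding lo_def hi_def by (simp add: divide_strict_right_mono)
  \<comment> \<open>Rounding up loses less than one interval length, and the weight of the request
    is two interval lengths.\<close>
  have hi: "hi i \<le> A (Suc i)" if "V i" for i
  proof -
    have "Q i * 2 ^ ?E i < ?N i * 2 ^ Suc (L i) + 2 ^ ?E i" unfolding Q_def by (rule ceil_div) simp
    then have "real (Q i * 2 ^ ?E i) < real (?N i * 2 ^ Suc (L i) + 2 ^ ?E i)"
      by (simp only: of_nat_less_iff)
    then have "lo i < A i + 1 / 2 ^ Suc (L i)"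
      unfolding A_def lo_def sum_weight_eq by (simp add: field_simps)
    moreover have "A (Suc i) = A i + 2 * (1 / 2 ^ Suc (L i))"
      using that by (simp add: A_def weight_def power_one_over)
    moreover have "hi i = lo i + 1 / 2 ^ Suc (L i)"
      by (simp add: hi_def lo_def add_divide_distrib)
    ultimately show ?thesis by linarith
  qed
  have Q_less: "Q i < 2 ^ Suc (L i)" if "V i" for i
  proof -
    have "hi i \<le> 1" using hi[OF that] le_1[of "Suc i"] unfolding A_def by linarith
    then have "real (Q i) + 1 \<le> 2 ^ Suc (L i)" unfolding hi_def by (simp add: field_simps)
    then have "real (Q i) < real (2 ^ Suc (L i))" by simp
    then show ?thesis by (simp only: of_nat_less_iff)
  qed
  have J_Suc: "J i + 1 = 2 ^ Suc (L i) + Q i" for i unfolding J_def by simp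
  have len: "str_len (J i) = Suc (L i)" if "V i" for i
    using Q_less[OF that] by (intro str_len_unique) (simp_all add: J_Suc[simplified])
  \<comment> \<open>If one string is a prefix of another, its dyadic interval contains the other
    one; but intervals of different valid requests do not overlap.\<close>
  have prefix: "i = j" if "V i" "V j" "prefix (str_of_nat (J i)) (str_of_nat (J j))" for i j
  proof -
    from prefix_number[OF that(3)] have le: "L i \<le> L j" and
      eq: "(J j + 1) div 2 ^ (L j - L i) = J i + 1"
      unfolding len[OF that(1)] len[OF that(2)] by auto
    define d where "d = L j - L i"
    have Lj: "L j = L i + d" using le by (simp add: d_def)
    have "(J i + 1) * 2 ^ d \<le> J j + 1"
      unfolding eq[symmetric] d_def by (rule div_times_less_eq_dividend)
    moreover have "J j + 1 < (J i + 1) * 2 ^ d + 2 ^ d"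
      unfolding eq[symmetric] d_def[symmetric]
      by (metis add.commute add_less_mono1 div_mod_decomp mod_less_divisor zero_less_numeral
          zero_less_power nat_add_left_cancel_less)
    ultimately have "Q i * 2 ^ d \<le> Q j" "Q j < Q i * 2 ^ d + 2 ^ d"
      unfolding J_Suc Lj by (simp_all add: power_add algebra_simps)
    then have "real (Q i * 2 ^ d) \<le> real (Q j)" "real (Q j + 1) \<le> real (Q i * 2 ^ d + 2 ^ d)"
      by (simp_all only: of_nat_le_iff Suc_eq_plus1[symmetric] Suc_le_eq)
    moreover have "lo i = real (Q i * 2 ^ d) / 2 ^ Suc (L j)"
      "hi i = real (Q i * 2 ^ d + 2 ^ d) / 2 ^ Suc (L j)"
      by (simp_all add: lo_def hi_def Lj power_add field_simps)
    moreover have "hi j = real (Q j + 1) / 2 ^ Suc (L j)" by (simp add: hi_def)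
    ultimately have "lo i \<le> lo j" "hi j \<le> hi i"
      unfolding lo_def[of j] by (simp_all only: divide_right_mono zero_le_power zero_le_numeral)
    show ?thesis
    proof (rule ccontr)
      assume "i \<noteq> j"
      then consider "i < j" | "j < i" by linarith
      then show False
      proof cases
        case 1
        then have "A (Suc i) \<le> A j" by (intro A_mono) simp
        then show False using hi[OF that(1)] lo[of j] lo_hi[of j] \<open>hi j \<le> hi i\<close> by linarith
      next
        case 2
        then have "A (Suc j) \<le> A i" by (intro A_mono) simp
        then show False using hi[OF that(2)] lo[of i] lo_hi[of j] \<open>lo i \<le> lo j\<close> by linarith
      qed
    qed
  qed
  have J_inj: "i = j" if "V i" "V j" "J i = J j" for i j
    using prefix[OF that(1,2)] that(3) by simp
  let ?s = "\<lambda>i j. if V i \<and> J i = j then Suc (out i) else 0"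
  have "recursive2 ?s"
    by (intro rec_intros recursive_comp[OF V] recursive_comp[OF rJ] recursive_comp[OF out])
  moreover have "y = y'" if "?s i j = Suc y" "?s i' j = Suc y'" for i i' j y y'
    using that J_inj[of i i'] by (simp split: if_splits)
  ultimately obtain \<nu> where \<nu>: "partial_recursive \<nu>" "\<And>j y. \<nu> j = Some y \<longleftrightarrow> (\<exists>i. ?s i j = Suc y)"
    using partial_recursive_of_stages[of ?s] by blast
  have \<nu>_J: "\<nu> (J i) = Some (out i)" if "V i" for i unfolding \<nu>(2) using that by auto
  have dom: "dom \<nu> = J ` {i. V i}"
    unfolding dom_def using \<nu>_J by (auto simp: \<nu>(2) split: if_splits)
  show ?thesis
  proof (rule that[of "on_strings \<nu>"])
    show "prefix_free_machine (on_strings \<nu>)"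
    proof (rule on_strings_prefix_free[OF \<nu>(1)])
      fix i j assume "i \<in> dom \<nu>" "j \<in> dom \<nu>" "prefix (str_of_nat i) (str_of_nat j)"
      then show "i = j" unfolding dom using prefix by blast
    qed
    show "complexity (on_strings \<nu>) (str_of_nat (out i)) \<le> enat (Suc (L i))" if "V i" for i
      unfolding complexity_le_iff_number on_numbers_on_strings
      using \<nu>_J[OF that] len[OF that] by (intro exI[of _ "J i"]) simp
    \<comment> \<open>The strings are one bit longer than requested, so the measure of the domain is
      half the total weight and the modulus \<open>v\<close> still works.\<close>
    let ?L = "\<lambda>i. Suc (L i)"
    have half: "weight V ?L i = weight V L i / 2" for i by (simp add: weight_def)
    have "summable (weight V ?L)"
    proof (rule bounded_imp_summable)
      show "(\<Sum>i\<le>n. weight V ?L i) \<le> 1" for n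
      proof -
        have "(\<Sum>i\<le>n. weight V ?L i) = (\<Sum>i<Suc n. weight V L i) / 2"
          unfolding half lessThan_Suc_atMost by (simp add: sum_divide_distrib)
        then show ?thesis using le_1[of "Suc n"] by simp
      qed
    qed simp
    then obtain \<beta> where \<beta>: "weight V ?L sums \<beta>" unfolding summable_def by blast
    have "(\<Sum>i\<in>{v k..<J}. weight V ?L i) \<le> (1 / 2) ^ k" for k J
    proof -
      have "(\<Sum>i\<in>{v k..<J}. weight V ?L i) = (\<Sum>i\<in>{v k..<J}. weight V L i) / 2"
        unfolding half by (simp add: sum_divide_distrib)
      then show ?thesis using v(2)[of k J] zero_le_power[of "1/2::real" k] by linarith
    qed
    then have "recursive_real \<beta>"
      by (intro recursive_real_of_tail[OF V _ \<beta> v(1)] rec_intros L)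
    moreover have "((\<lambda>\<tau>. (1 / 2) ^ length \<tau>) has_sum \<beta>) (dom (on_strings \<nu>))"
    proof -
      have "(weight V ?L has_sum \<beta>) UNIV" by (rule sums_nonneg_imp_has_sum[OF \<beta>]) simp
      then have "((\<lambda>i. (1 / 2) ^ length (str_of_nat (J i))) has_sum \<beta>) {i. V i}"
        by (rule has_sum_cong_neutral[THEN iffD1, rotated -1]) (auto simp: weight_def len)
      moreover have "inj_on (\<lambda>i. str_of_nat (J i)) {i. V i}"
        using J_inj inj_str_of_nat by (auto simp: inj_on_def)
      ultimately have "((\<lambda>\<tau>. (1 / 2) ^ length \<tau>) has_sum \<beta>) ((\<lambda>i. str_of_nat (J i)) ` {i. V i})"
        by (subst has_sum_reindex) (simp_all add: o_def)
      then show ?thesis unfolding dom_on_strings dom image_image .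
    qed
    ultimately show "recursive_measure_domain (on_strings \<nu>)"
      unfolding recursive_measure_domain_def by blast
  qed
qed

section \<open>Schnorr trivial sets\<close>

lemma sum_half_powers_le:
  assumes "finite F" "F \<subseteq> {m..}" shows "(\<Sum>i\<in>F. (1 / 2) ^ i) \<le> (2 * (1 / 2) ^ m :: real)"
proof -
  have "(\<Sum>i\<in>F. (1 / 2) ^ i) \<le> (\<Sum>i\<in>{m..<m + n}. (1 / 2) ^ i :: real)" if "F \<subseteq> {m..<m + n}" for n
    using that by (intro sum_mono2) auto
  moreover have "(\<Sum>i\<in>{m..<m + n}. (1 / 2) ^ i) = 2 * (1 / 2) ^ m - (2 * (1 / 2) ^ (m + n) :: real)" for n
    by (induction n) auto
  moreover have "F \<subseteq> {m..<m + Suc (Max (insert 0 F))}"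
    using assms by (auto intro!: trans_le_add2 le_imp_less_Suc)
  moreover have "0 \<le> (2 * (1 / 2) ^ (m + Suc (Max (insert 0 F))) :: real)" by simp
  ultimately show ?thesis by (smt (verit))
qed

text \<open>Pairing each program with its first halting stage makes the domain the one-to-one image
  of a decidable set.\<close>

lemma machine_enumeration:
  assumes "machine M"
  obtains val L out where "decidable val" "recursive L" "recursive out"
    "bij_betw (\<lambda>q. str_of_nat (lft q)) {q. val q} (dom M)"
    "\<And>q. L q = length (str_of_nat (lft q))"
    "\<And>q. val q \<Longrightarrow> M (str_of_nat (lft q)) = Some (str_of_nat (out q))"
proof -
  obtain s where s: "stage_function s (on_numbers M)"
    using assms partial_recursive_stage unfolding machine_iff by blast
  then have rs: "recursive2 s" unfolding stage_function_def by blast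
  define val where "val q \<longleftrightarrow> s (rgt q) (lft q) \<noteq> 0 \<and> (\<forall>t<rgt q. s t (lft q) = 0)" for q
  have out: "M (str_of_nat (lft q)) = Some (str_of_nat (s (rgt q) (lft q) - 1))" if "val q" for q
  proof -
    have "s (rgt q) (lft q) = Suc (s (rgt q) (lft q) - 1)" using that by (simp add: val_def)
    then have "on_numbers M (lft q) = Some (s (rgt q) (lft q) - 1)"
      using s unfolding stage_function_def by blast
    then show ?thesis by (simp add: on_numbers_eq_Some)
  qed
  have "bij_betw (\<lambda>q. str_of_nat (lft q)) {q. val q} (dom M)"
    unfolding bij_betw_def
  proof (intro conjI equalityI subsetI inj_onI)
    fix q q' assume *: "q \<in> {q. val q}" "q' \<in> {q. val q}" "str_of_nat (lft q) = str_of_nat (lft q')"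
    then have "lft q = lft q'" using inj_str_of_nat by (simp add: inj_eq)
    moreover from this have "rgt q = rgt q'"
      using * unfolding val_def mem_Collect_eq by (metis linorder_neqE_nat)
    ultimately show "q = q'" by (metis pair_lft_rgt)
  next
    fix \<tau> assume "\<tau> \<in> dom M"
    then have "nat_of_str \<tau> \<in> dom (on_numbers M)" by (auto simp: on_numbers_def)
    then have "\<exists>t. s t (nat_of_str \<tau>) \<noteq> 0" unfolding stage_function_dom[OF s] .
    then obtain t where "s t (nat_of_str \<tau>) \<noteq> 0" "\<forall>t'<t. s t' (nat_of_str \<tau>) = 0"
      unfolding exists_least_iff[of "\<lambda>t. s t (nat_of_str \<tau>) \<noteq> 0"] by blast
    then have "val (pair (nat_of_str \<tau>) t)" by (simp add: val_def)
    then show "\<tau> \<in> (\<lambda>q. str_of_nat (lft q)) ` {q. val q}"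
      by (intro image_eqI[of _ _ "pair (nat_of_str \<tau>) t"]) simp_all
  qed (use out in blast)
  moreover have "decidable val" unfolding val_def by (intro rec_intros recursive2_comp[OF rs])
  moreover have "recursive (\<lambda>q. length (str_of_nat (lft q)))"
    unfolding length_str_of_nat by (intro rec_intros)
  moreover have "recursive (\<lambda>q. s (rgt q) (lft q) - 1)"
    by (intro rec_intros recursive2_comp[OF rs] recursive_pred)
  ultimately show ?thesis using that[of val _ "\<lambda>q. s (rgt q) (lft q) - 1"] out by blast
qed

text \<open>
  Batch \<open>m\<close> consists of the programs enumerated between \<open>v m\<close> and \<open>v (Suc m)\<close>. Their weight is at most
  \<open>2 ^ - (h m + m)\<close>, so that \<open>h m\<close> copies of each of them weigh at most \<open>2 ^ - m\<close>.
\<close>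

lemma schnorr_trivialI:
  assumes h: "recursive h"
    and approx: "\<And>u. recursive u \<Longrightarrow> \<exists>D m0. recursive3 (\<lambda>m w z. of_bool (D m w z)) \<and>
      (\<forall>m\<ge>m0. \<exists>w<h m. \<forall>z<u m. D m w z \<longleftrightarrow> z \<in> S)"
  shows "schnorr_trivial S"
  unfolding schnorr_trivial_def
proof (intro allI impI, elim conjE)
  fix M assume "prefix_free_machine M" and meas: "recursive_measure_domain M"
  then have "machine M" unfolding prefix_free_machine_def by blast
  then obtain val L out where val: "decidable val" and L: "recursive L" and ro: "recursive out"
    and bij: "bij_betw (\<lambda>q. str_of_nat (lft q)) {q. val q} (dom M)"
    and len: "\<And>q. L q = length (str_of_nat (lft q))"
    and out: "\<And>q. val q \<Longrightarrow> M (str_of_nat (lft q)) = Some (str_of_nat (out q))"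
    using machine_enumeration by metis
  obtain \<alpha> where \<alpha>: "((\<lambda>\<tau>. (1 / 2) ^ length \<tau>) has_sum \<alpha>) (dom M)" "recursive_real \<alpha>"
    using meas unfolding recursive_measure_domain_def by blast
  let ?\<omega> = "weight val L"
  have "((\<lambda>q. (1 / 2) ^ L q) has_sum \<alpha>) {q. val q}"
    using \<alpha>(1) unfolding has_sum_reindex_bij_betw[OF bij, symmetric] len .
  then have "(?\<omega> has_sum \<alpha>) UNIV"
    by (rule has_sum_cong_neutral[THEN iffD1, rotated -1]) (auto simp: weight_def)
  then have "?\<omega> sums \<alpha>" by (rule has_sum_imp_sums)
  then obtain v0 where v0: "recursive v0" "\<And>k J. (\<Sum>q\<in>{v0 k..<J}. ?\<omega> q) \<le> (1 / 2) ^ k"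
    using recursive_tail[OF val L _ \<alpha>(2)] by blast
  \<comment> \<open>The sum makes \<open>v\<close> monotone, and the summand \<open>m\<close>
    ensures that every \<open>q\<close> falls into some batch.\<close>
  define v where "v m = (\<Sum>i<Suc m. v0 (h i + i)) + m" for m
  have rv: "recursive v" unfolding v_def
    by (intro rec_intros recursive_comp[OF v0(1)] recursive_comp[OF h])
  have v_mono: "v m \<le> v n" if "m \<le> n" for m n
    unfolding v_def using that by (intro add_mono sum_mono2) auto
  have v_ge: "m \<le> v m" for m by (simp add: v_def)
  have v_tail: "(\<Sum>q\<in>I. ?\<omega> q) \<le> (1 / 2) ^ (h m + m)" if "finite I" "I \<subseteq> {v m..}" for I m
  proof -
    have "v0 (h m + m) \<le> v m" unfolding v_def by (simp add: trans_le_add2 trans_le_add1)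
    moreover have "\<forall>q\<in>I. q < Suc (Max (insert 0 I))" using that(1) by (auto simp: less_Suc_eq_le)
    ultimately have "I \<subseteq> {v0 (h m + m)..<Suc (Max (insert 0 I))}" using that(2) by fastforce
    then have "(\<Sum>q\<in>I. ?\<omega> q) \<le> (\<Sum>q\<in>{v0 (h m + m)..<Suc (Max (insert 0 I))}. ?\<omega> q)"
      by (intro sum_mono2) auto
    also have "\<dots> \<le> (1 / 2) ^ (h m + m)" by (rule v0)
    finally show ?thesis .
  qed
  define u where "u m = (\<Sum>q<v (Suc m). out q)" for m
  have "recursive u" unfolding u_def by (intro rec_intros recursive_comp[OF ro] recursive_comp[OF rv])
  then obtain D m0 where D: "recursive3 (\<lambda>m w z. of_bool (D m w z))"
    "\<And>m. m \<ge> m0 \<Longrightarrow> \<exists>w<h m. \<forall>z<u m. D m w z \<longleftrightarrow> z \<in> S"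
    using approx by blast
  \<comment> \<open>The batch of \<open>q\<close>, where all early programs are put into batch
    \<open>m0\<close>, the first one known to have a correct guess.\<close>
  define B where "B q = (LEAST m. m0 \<le> m \<and> q < v (Suc m))" for q
  have B_ex: "\<exists>m. m0 \<le> m \<and> q < v (Suc m)" for q
    using v_ge[of "Suc (max m0 q)"] by (intro exI[of _ "max m0 q"]) simp
  have B: "m0 \<le> B q" "q < v (Suc (B q))" for q
    using LeastI_ex[OF B_ex] unfolding B_def by blast+
  have B_v: "v (B q) \<le> q" if "v m0 \<le> q" for q
  proof (cases "B q = m0")
    case False
    then obtain k where k: "B q = Suc k" "m0 \<le> k" using B(1)[of q] by (cases "B q") auto
    then have "k < (LEAST m. m0 \<le> m \<and> q < v (Suc m))" unfolding B_def by simp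
    then have "\<not> (m0 \<le> k \<and> q < v (Suc k))" by (rule not_less_Least)
    then show ?thesis using k by simp
  qed (use that in simp)
  have rB: "recursive B" unfolding B_def by (intro rec_intros recursive_comp[OF rv] B_ex)
  \<comment> \<open>The weight of all copies of program \<open>q\<close>, one for each
    guess.\<close>
  define T where "T q = ?\<omega> q * real (h (B q))" for q
  have T_nonneg: "0 \<le> T q" for q by (simp add: T_def)
  have T_tail: "(\<Sum>q\<in>I. T q) \<le> 2 * (1 / 2) ^ m" if I: "finite I" "I \<subseteq> {v m..}" "m0 \<le> m" for I m
  proof -
    have "m \<le> B q" "v (B q) \<le> q" if "q \<in> I" for q
    proof -
      have "v m \<le> q" using I(2) that by auto
      then show "v (B q) \<le> q" using B_v v_mono[OF I(3)] by simp
      show "m \<le> B q"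
      proof (rule ccontr)
        assume "\<not> m \<le> B q"
        then have "v (Suc (B q)) \<le> v m" by (intro v_mono) simp
        then show False using B(2)[of q] \<open>v m \<le> q\<close> by simp
      qed
    qed
    note BI = this
    have "(\<Sum>q\<in>I. T q) = (\<Sum>n\<in>B ` I. \<Sum>q\<in>{q \<in> I. B q = n}. T q)"
      by (rule sum.image_gen[OF I(1)])
    also have "\<dots> \<le> (\<Sum>n\<in>B ` I. (1 / 2) ^ n)"
    proof (rule sum_mono)
      fix n assume "n \<in> B ` I"
      have "(\<Sum>q\<in>{q \<in> I. B q = n}. T q) = (\<Sum>q\<in>{q \<in> I. B q = n}. ?\<omega> q) * real (h n)"
        unfolding T_def sum_distrib_right by (intro sum.cong) auto
      also have "\<dots> \<le> (1 / 2) ^ (h n + n) * 2 ^ h n"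
        using I(1) BI(2) less_exp[of "h n"]
        by (intro mult_mono v_tail) (auto simp: of_nat_less_two_power less_imp_le)
      also have "\<dots> = (1 / 2) ^ n" by (simp add: power_add power_one_over)
      finally show "(\<Sum>q\<in>{q \<in> I. B q = n}. T q) \<le> (1 / 2) ^ n" .
    qed
    also have "\<dots> \<le> 2 * (1 / 2) ^ m" using I(1) BI(1) by (intro sum_half_powers_le) auto
    finally show ?thesis .
  qed
  \<comment> \<open>The tail estimate does not reach the programs below \<open>v m0\<close>; their
    finite weight is absorbed by lengthening every program by \<open>c\<close>.\<close>
  obtain c where c: "(\<Sum>q<v m0. T q) + 2 < 2 ^ c"
    using real_arch_pow[of 2 "(\<Sum>q<v m0. T q) + 2"] by auto
  have T_total: "(\<Sum>q<J. T q) \<le> 2 ^ c" for J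
  proof -
    have "(\<Sum>q<J. T q) \<le> (\<Sum>q\<in>{..<v m0} \<union> {v m0..<J}. T q)"
      using T_nonneg by (intro sum_mono2) auto
    also have "\<dots> = (\<Sum>q<v m0. T q) + (\<Sum>q\<in>{v m0..<J}. T q)" by (rule sum.union_disjoint) auto
    also have "(\<Sum>q\<in>{v m0..<J}. T q) \<le> 2 * (1 / 2) ^ m0" by (rule T_tail) auto
    also have "\<dots> \<le> 2" by (simp add: power_le_one)
    finally show ?thesis using c by simp
  qed
  \<comment> \<open>A request pairs a program \<open>q\<close> with a guess \<open>w\<close>; its
    output is the prefix of length \<open>out q\<close> of the set described by the guess.\<close>
  define V where "V i \<longleftrightarrow> val (lft i) \<and> rgt i < h (B (lft i))" for i
  define L' where "L' i = L (lft i) + c" for i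
  define out' where "out' i = code {z. D (B (lft i)) (rgt i) z} (out (lft i))" for i
  have rV: "decidable V" unfolding V_def
    by (intro rec_intros recursive_comp[OF val] recursive_comp[OF h] recursive_comp[OF rB])
  have rL': "recursive L'" unfolding L'_def by (intro rec_intros recursive_comp[OF L])
  have rout': "recursive out'" unfolding out'_def
    by (intro rec_intros recursive3_comp[OF D(1)] recursive_comp[OF ro] recursive_comp[OF rB])
  have W: "(\<Sum>i\<in>I. weight V L' i) \<le> (\<Sum>q\<in>Q. T q) * (1 / 2) ^ c"
    if "finite I" "finite Q" "\<And>i. i \<in> I \<Longrightarrow> V i \<Longrightarrow> lft i \<in> Q" for I Q
  proof -
    let ?P = "SIGMA q:Q. {..<h (B q)}"
    have "(\<Sum>i\<in>I. weight V L' i) = (\<Sum>i\<in>{i \<in> I. V i}. weight V L' i)"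
      using that(1) by (intro sum.mono_neutral_right) (auto simp: weight_def)
    also have "\<dots> \<le> (\<Sum>i\<in>prod_encode ` ?P. weight V L' i)"
    proof (rule sum_mono2)
      show "{i \<in> I. V i} \<subseteq> prod_encode ` ?P"
      proof
        fix i assume i: "i \<in> {i \<in> I. V i}"
        then have "prod_decode i \<in> ?P"
          using that(3)[of i] by (cases "prod_decode i") (auto simp: V_def)
        then show "i \<in> prod_encode ` ?P" by (metis image_eqI prod_decode_inverse)
      qed
    qed (use that(2) in auto)
    also have "\<dots> = (\<Sum>(q, w)\<in>?P. weight V L' (pair q w))"
      using inj_prod_encode by (subst sum.reindex) (auto simp: inj_on_def o_def split_def)
    also have "\<dots> = (\<Sum>q\<in>Q. \<Sum>w<h (B q). weight V L' (pair q w))"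
      using that(2) by (subst sum.Sigma) auto
    also have "\<dots> = (\<Sum>q\<in>Q. T q * (1 / 2) ^ c)"
      by (intro sum.cong) (auto simp: weight_def V_def L'_def T_def power_add)
    finally show ?thesis by (simp add: sum_distrib_right)
  qed
  have le_1: "(\<Sum>i<J. weight V L' i) \<le> 1" for J
  proof -
    have "lft i \<le> i" for i using le_prod_encode_1[of "lft i" "rgt i"] by simp
    then have "(\<Sum>i<J. weight V L' i) \<le> (\<Sum>q<J. T q) * (1 / 2) ^ c"
      by (intro W) (auto intro: le_less_trans)
    also have "\<dots> \<le> 2 ^ c * (1 / 2) ^ c" by (intro mult_right_mono T_total) simp
    finally show ?thesis by (simp add: power_one_over)
  qed
  \<comment> \<open>A valid request for some \<open>q < v (m0 + Suc k)\<close> has a smaller number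
    than this, so only late programs remain. The \<open>Suc\<close> offsets the factor 2 in
    \<open>T_tail\<close>.\<close>
  define v' where "v' k = Suc (pair (v (m0 + Suc k)) (\<Sum>q<v (m0 + Suc k). h (B q)))" for k
  have rv': "recursive v'" unfolding v'_def
    by (intro rec_intros recursive_comp[OF rv] recursive_comp[OF h] recursive_comp[OF rB])
  have tail': "(\<Sum>i\<in>{v' k..<J}. weight V L' i) \<le> (1 / 2) ^ k" for k J
  proof -
    let ?m = "m0 + Suc k"
    have "lft i \<in> {v ?m..<J}" if "i \<in> {v' k..<J}" "V i" for i
    proof -
      have "lft i \<le> i" using le_prod_encode_1[of "lft i" "rgt i"] by simp
      moreover have "v ?m \<le> lft i"
      proof (rule ccontr)
        assume less: "\<not> v ?m \<le> lft i"
        then have "h (B (lft i)) \<le> (\<Sum>q<v ?m. h (B q))" by (intro member_le_sum) auto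
        then have "pair (lft i) (rgt i) \<le> pair (v ?m) (\<Sum>q<v ?m. h (B q))"
          using less that(2) by (intro pair_mono) (auto simp: V_def)
        then show False using that(1) unfolding v'_def by simp
      qed
      ultimately show ?thesis using that(1) by auto
    qed
    then have "(\<Sum>i\<in>{v' k..<J}. weight V L' i) \<le> (\<Sum>q\<in>{v ?m..<J}. T q) * (1 / 2) ^ c"
      by (intro W) auto
    also have "\<dots> \<le> (2 * (1 / 2) ^ ?m) * 1"
      by (intro mult_mono T_tail power_le_one) (auto intro: sum_nonneg T_nonneg)
    also have "\<dots> = (1 / 2) ^ m0 * (1 / 2) ^ k" by (simp add: power_add)
    also have "\<dots> \<le> 1 * (1 / 2) ^ k" by (intro mult_right_mono power_le_one) auto
    finally show ?thesis by simp
  qed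
  obtain N where N: "prefix_free_machine N" "recursive_measure_domain N"
    "\<And>i. V i \<Longrightarrow> complexity N (str_of_nat (out' i)) \<le> enat (Suc (L' i))"
    using kraft_machine[OF rV rL' rout' le_1 rv' tail'] by blast
  have "complexity N (initial_segment S n) \<le> complexity M (str_of_nat n) + enat (Suc c)" for n
  proof (cases "complexity M (str_of_nat n)")
    case (enat l)
    then obtain \<tau> where \<tau>: "M \<tau> = Some (str_of_nat n)" "length \<tau> \<le> l"
      using complexity_le_iff[of M "str_of_nat n" l] by auto
    then have "\<tau> \<in> (\<lambda>q. str_of_nat (lft q)) ` {q. val q}"
      using bij_betw_imp_surj_on[OF bij] by blast
    then obtain q where q: "val q" "\<tau> = str_of_nat (lft q)" by blast
    then have n: "out q = n" using out[OF q(1)] \<tau>(1) inj_str_of_nat by (simp add: inj_eq)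
    obtain w where w: "w < h (B q)" "\<And>z. z < u (B q) \<Longrightarrow> D (B q) w z \<longleftrightarrow> z \<in> S"
      using D(2)[OF B(1)] by blast
    have "out q \<le> u (B q)" unfolding u_def using B(2) by (intro member_le_sum) auto
    then have "code {z. D (B q) w z} n = code S n"
      using w(2) n by (intro code_cong) simp
    then have "out' (pair q w) = code S n" using n by (simp add: out'_def)
    moreover have "V (pair q w)" using q(1) w(1) by (simp add: V_def)
    ultimately have "complexity N (initial_segment S n) \<le> enat (Suc (L' (pair q w)))"
      unfolding initial_segment_eq using N(3) by metis
    also have "\<dots> \<le> enat (l + Suc c)" using \<tau>(2) q(2) by (simp add: L'_def len)
    finally show ?thesis using enat by simp
  qed simp
  then show "\<exists>N c. prefix_free_machine N \<and> recursive_measure_domain N \<and>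
      (\<forall>n. complexity N (initial_segment S n) \<le> complexity M (str_of_nat n) + enat c)"
    using N(1,2) by blast
qed

text \<open>Positional notation: a single number below \<open>B ^ n\<close> serves as a guess at a
  whole sequence of codes.\<close>

lemma digits_exist:
  assumes "\<And>k. k < n \<Longrightarrow> c k < (B::nat)"
  shows "\<exists>w<B ^ n. \<forall>k<n. w div B ^ k mod B = c k"
  using assms
proof (induction n)
  case (Suc n)
  then obtain w where w: "w < B ^ n" "\<And>k. k < n \<Longrightarrow> w div B ^ k mod B = c k" by force
  have B: "0 < B" using Suc.prems[of n] by simp
  let ?w = "w + c n * B ^ n"
  have "?w < B ^ n + c n * B ^ n" using w(1) by simp
  also have "\<dots> = Suc (c n) * B ^ n" by simp
  also have "\<dots> \<le> B * B ^ n" using Suc.prems[of n] by (intro mult_le_mono1) simp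
  finally have "?w < B ^ Suc n" by simp
  moreover have "?w div B ^ k mod B = c k" if k: "k < Suc n" for k
  proof (cases "k = n")
    case True
    then show ?thesis using w(1) B Suc.prems[of n] by simp
  next
    case False
    then obtain d where d: "n = k + Suc d" using k less_imp_Suc_add[of k n] by auto
    have "?w div B ^ k = (w + c n * B ^ d * B * B ^ k) div B ^ k"
      by (simp add: d power_add algebra_simps)
    also have "\<dots> = w div B ^ k + c n * B ^ d * B" using B by simp
    finally have "?w div B ^ k mod B = w div B ^ k mod B" by simp
    then show ?thesis using w(2)[of k] False k by simp
  qed
  ultimately show ?case by blast
qed simp

text \<open>Below \<open>u m\<close> the set depends only on \<open>c 0\<close> to
  \<open>c m\<close>, and these codes also reveal which entry \<open>K x\<close> is. Thus the number
  of guesses is bounded independently of \<open>u\<close>, as \<open>schnorr_trivialI\<close>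
  requires.\<close>

theorem anti_complex_imp_schnorr_trivial:
  assumes "optimal U" "anti_complex U A"
  shows "\<exists>S. schnorr_trivial S \<and> wtt_reducible A S"
proof -
  obtain c b p conv \<psi> where b: "recursive b" "mono b" and c: "\<And>k. c k < b k"
    and conv: "decidable2 conv" "\<And>k x. conv x (c k) \<longleftrightarrow> p k \<le> x"
    and dom: "\<And>f. recursive f \<Longrightarrow> \<exists>k0. \<forall>k\<ge>k0. f k \<le> p k"
    and \<psi>: "partial_recursive \<psi>" "\<And>k. \<exists>n\<ge>p k. \<psi> (c k) = Some (code A n)"
    by (rule anti_complex_codes[OF assms]) (rule that; assumption)
  \<comment> \<open>Domination of the successor function makes \<open>K\<close> total and gives the
    recursive bound \<open>k0 + x\<close> on \<open>K x\<close>, hence a recursive use.\<close>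
  obtain k0 where k0: "\<And>k. k \<ge> k0 \<Longrightarrow> Suc k \<le> p k"
    using dom[of Suc] rec_intros by blast
  define K where "K x = (LEAST k. x < p k)" for x
  have ex: "x < p (max k0 x)" for x using k0[of "max k0 x"] by simp
  have K: "x < p (K x)" for x unfolding K_def using ex by (rule LeastI)
  have K_le: "K x \<le> k" if "x < p k" for x k unfolding K_def using that by (rule Least_le)
  let ?S = "{pair x (c (K x)) | x. True}"
  let ?\<psi> = "\<lambda>z. map_option (\<lambda>w. of_bool (smem w (lft z))) (\<psi> (rgt z))"
  have p\<psi>: "partial_recursive ?\<psi>"
    by (intro partial_recursive_map[OF \<psi>(1)] rec_intros)
  have val: "?\<psi> (pair x (c (K x))) = Some (char_fun A x)" for x
  proof -
    obtain n where "n \<ge> p (K x)" "\<psi> (c (K x)) = Some (code A n)" using \<psi>(2) by blast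
    then show ?thesis using K[of x] by (simp add: smem_code char_fun_def)
  qed
  obtain e where e: "computes e ?S (char_fun A)"
    "\<And>x. queries e ?S x \<subseteq> pair x ` {..c (K x)}"
    using graph_reduction[where c = "\<lambda>x. c (K x)" and F = "char_fun A" and ?x0.0 = 0,
        OF refl recursive_id p\<psi> val] by auto
  have "wtt_reducible A ?S"
    unfolding wtt_reducible_def
  proof (rule fun_wtt_reducibleI[OF e(1)])
    show "recursive (\<lambda>x. Suc (pair x (b (k0 + x))))"
      by (intro rec_intros recursive_comp[OF b(1)])
    fix x q assume "q \<in> queries e ?S x"
    then obtain i where i: "q = pair x i" "i \<le> c (K x)" using e(2) by blast
    have "K x \<le> k0 + x" using K_le[OF ex[of x]] by simp
    then have "i \<le> b (k0 + x)" using i(2) c[of "K x"] b(2) by (meson le_trans less_imp_le monoD)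
    then show "q < Suc (pair x (b (k0 + x)))" unfolding i(1) by (simp add: less_Suc_eq_le pair_mono)
  qed
  moreover have "schnorr_trivial ?S"
  proof (rule schnorr_trivialI)
    \<comment> \<open>There are \<open>Suc m\<close> codes to guess, each below
      \<open>b m\<close>.\<close>
    show "recursive (\<lambda>m. b m ^ Suc m)" by (intro rec_intros b(1))
    fix u assume "recursive u"
    then obtain m0 where m0: "\<And>m. m \<ge> m0 \<Longrightarrow> u m \<le> p m" using dom by blast
    define digit where "digit m w k = w div b m ^ k mod b m" for m w k
    \<comment> \<open>The search finds \<open>K (lft z)\<close> as the first index whose code denies
      \<open>p k \<le> lft z\<close>. Stopping at \<open>m\<close> is harmless, since
      \<open>p m\<close> exceeds \<open>lft z\<close> whenever \<open>z < u m\<close> and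
      \<open>m \<ge> m0\<close>.\<close>
    define D where "D m w z \<longleftrightarrow>
      digit m w (LEAST k. k = m \<or> \<not> conv (lft z) (digit m w k)) = rgt z" for m w z
    have "recursive3 digit" unfolding digit_def by (intro rec_intros recursive_comp[OF b(1)])
    note [rec_intros] = recursive3_comp[OF this]
    have "\<exists>k. k = m \<or> \<not> conv (lft z) (digit m w k)" for m w z by blast
    then have "recursive3 (\<lambda>m w z. of_bool (D m w z))"
      unfolding D_def
      by (intro rec_intros recursive2_comp[of "\<lambda>x c. of_bool (conv x c)", OF conv(1)])
    moreover have "\<exists>w<b m ^ Suc m. \<forall>z<u m. D m w z \<longleftrightarrow> z \<in> ?S" if m: "m \<ge> m0" for m
    proof -
      have "c k < b m" if "k < Suc m" for k
        using c[of k] b(2) that by (meson less_Suc_eq_le less_le_trans monoD)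
      then obtain w where w: "w < b m ^ Suc m" "\<And>k. k < Suc m \<Longrightarrow> digit m w k = c k"
        using digits_exist[of "Suc m" c "b m"] unfolding digit_def by blast
      have "D m w z \<longleftrightarrow> z \<in> ?S" if z: "z < u m" for z
      proof -
        have "lft z \<le> z" using le_prod_encode_1[of "lft z" "rgt z"] by simp
        then have "lft z < p m" using z m0[OF m] by simp
        then have Km: "K (lft z) \<le> m" by (rule K_le)
        have "(LEAST k. k = m \<or> \<not> conv (lft z) (digit m w k)) = K (lft z)"
        proof (rule Least_equality)
          show "K (lft z) = m \<or> \<not> conv (lft z) (digit m w (K (lft z)))"
            using w(2)[of "K (lft z)"] Km K[of "lft z"] conv(2) by simp
          show "K (lft z) \<le> k" if k: "k = m \<or> \<not> conv (lft z) (digit m w k)" for k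
          proof (cases "k \<le> m")
            case True
            then have "lft z < p k" using k \<open>lft z < p m\<close> w(2)[of k] conv(2) by auto
            then show ?thesis by (rule K_le)
          qed (use Km in simp)
        qed
        then have "D m w z \<longleftrightarrow> c (K (lft z)) = rgt z"
          unfolding D_def using w(2)[of "K (lft z)"] Km by simp
        also have "\<dots> \<longleftrightarrow> z \<in> ?S"
        proof
          show "z \<in> ?S" if "c (K (lft z)) = rgt z"
            using that by (intro CollectI exI[of _ "lft z"]) simp
        qed auto
        finally show ?thesis .
      qed
      then show ?thesis using w(1) by blast
    qed
    ultimately show "\<exists>D m0. recursive3 (\<lambda>m w z. of_bool (D m w z)) \<and>
        (\<forall>m\<ge>m0. \<exists>w<b m ^ Suc m. \<forall>z<u m. D m w z \<longleftrightarrow> z \<in> ?S)"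
      by blast
  qed
  ultimately show ?thesis by blast
qed

theorem theorem1p3:
  fixes A :: "nat set" and U :: "bool list \<Rightarrow> bool list option"
  assumes "optimal U"
  shows "((\<exists>B. tiny_use_reducible A B) \<longleftrightarrow> anti_complex U A) \<and>
    (anti_complex U A \<longleftrightarrow> re_traceable_degree (wtt_degree A)) \<and>
    (re_traceable_degree (wtt_degree A) \<longleftrightarrow> (\<exists>S. schnorr_trivial S \<and> wtt_reducible A S))"
proof -
  have "machine U" using assms unfolding optimal_def by blast
  then show ?thesis
    using tiny_use_imp_anti_complex[OF assms] anti_complex_imp_tiny_use[OF assms]
      anti_complex_imp_re_traceable re_traceable_imp_anti_complex[OF assms]
      schnorr_trivial_imp_anti_complex[OF assms] anti_complex_imp_schnorr_trivial[OF assms]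
    by blast
qed

end
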